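(* Let $f\colon\mathbb{D}\to\mathbb{D}$ be a non-elliptic map whose Koenigs domain is not the whole complex plane. For all $p\geq1$ and $\alpha>-1$, we have that (a) $\displaystyle \liminf_{n\to+\infty}\frac{\log\lVert C_f^{\,n}\rVert_{H^p}}{\log n}\geq \frac{1}{2p}$; and (b) $\displaystyle \liminf_{n\to+\infty}\frac{\log\lVert C_f^{\,n}\rVert_{A^p_\alpha}}{\log n}\geq \frac{2+\alpha}{2p}$.
   Context: $\mathbb{D}$ is the open unit disc and $\mathbb{N}=\{1,2,\dots\}$. A holomorphic map $f\colon\mathbb{D}\to\mathbb{D}$ is non-elliptic if it has no fixed point in $\mathbb{D}$; $f^n$ denotes its $n$-th iterate. A domain $\Omega\subseteq\mathbb{C}$ is starlike at infinity if $\Omega+t\subseteq\Omega$ for all $t\ge 0$; it is asymptotically starlike at infinity if $\Omega+1\subseteq\Omega$ and $\bigcup_{n=1}^\infty(\Omega-n)$ is starlike at infinity. A simply connected domain $U\subseteq\mathbb{D}$ is a fundamental domain of $f$ if $f$ is univalent on $U$, $f(U)\subseteq U$ and $\bigcup_{n\in\mathbb{N}}f^{-n}(U)=\mathbb{D}$. For a non-elliptic $f$, a Koenigs domain and a Koenigs function are a domain $\Omega$ asymptotically starlike at infinity and an onto holomorphic map $h\colon\mathbb{D}\to\Omega$ with $h\circ f=h+1$ and such that $h$ is univalent on some fundamental domain of $f$. Such a pair exists and is unique up to translation. $H^p$ is the Hardy space of holomorphic $g\colon\mathbb{D}\to\mathbb{C}$ with $\sup_{r\in[0,1)}\int_0^{2\pi}|g(re^{i\theta})|^p\,d\theta<+\infty$,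 and $A^p_\alpha$ is the weighted Bergman space of holomorphic $g\colon\mathbb{D}\to\mathbb{C}$ with $\int_{\mathbb{D}}|g(z)|^p(1-|z|^2)^\alpha\,dA(z)<+\infty$ ($dA$ normalized area measure), each with its usual norm (the $p$-th root of the displayed quantity, up to normalization). The composition operator $C_f(g)=g\circ f$ is bounded on each of these spaces, $C_f^{\,n}:=C_{f^n}$, and $\lVert\cdot\rVert_{H^p}$, $\lVert\cdot\rVert_{A^p_\alpha}$ denote the operator norms on $H^p$, $A^p_\alpha$. *)

theory Defs
  imports "HOL-Complex_Analysis.Complex_Analysis"
begin

text \<open>
  Functions on the unit disc are represented by total functions on the complex numbers;
  only their values on \<open>unit_disc\<close> matter in the definitions below.
\<close>

abbreviation unit_disc :: "complex set" where
  "unit_disc \<equiv> ball 0 1"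

definition plane_domain :: "complex set \<Rightarrow> bool" where
  "plane_domain \<Omega> \<longleftrightarrow> open \<Omega> \<and> connected \<Omega> \<and> \<Omega> \<noteq> {}"

definition non_elliptic :: "(complex \<Rightarrow> complex) \<Rightarrow> bool" where
  "non_elliptic f \<longleftrightarrow>
     f holomorphic_on unit_disc \<and> f ` unit_disc \<subseteq> unit_disc \<and> (\<forall>z\<in>unit_disc. f z \<noteq> z)"


definition starlike_at_infinity :: "complex set \<Rightarrow> bool" where
  "starlike_at_infinity \<Omega> \<longleftrightarrow>
     plane_domain \<Omega> \<and> (\<forall>t::real. t \<ge> 0 \<longrightarrow> (\<lambda>w. w + of_real t) ` \<Omega> \<subseteq> \<Omega>)"

definition asymptotically_starlike_at_infinity :: "complex set \<Rightarrow> bool" where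
  "asymptotically_starlike_at_infinity \<Omega> \<longleftrightarrow>
     plane_domain \<Omega> \<and> (\<lambda>w. w + 1) ` \<Omega> \<subseteq> \<Omega> \<and>
     starlike_at_infinity (\<Union>n\<in>{1::nat..}. (\<lambda>w. w - of_nat n) ` \<Omega>)"

definition fundamental_domain :: "(complex \<Rightarrow> complex) \<Rightarrow> complex set \<Rightarrow> bool" where
  "fundamental_domain f U \<longleftrightarrow>
     U \<subseteq> unit_disc \<and> plane_domain U \<and> simply_connected U \<and>
     f holomorphic_on U \<and> inj_on f U \<and> f ` U \<subseteq> U \<and>
     (\<Union>n\<in>{1::nat..}. {z \<in> unit_disc. (f ^^ n) z \<in> U}) = unit_disc"

definition koenigs_pair ::
    "(complex \<Rightarrow> complex) \<Rightarrow> complex set \<Rightarrow> (complex \<Rightarrow> complex) \<Rightarrow> bool" where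
  "koenigs_pair f \<Omega> h \<longleftrightarrow>
     asymptotically_starlike_at_infinity \<Omega> \<and>
     h holomorphic_on unit_disc \<and> h ` unit_disc = \<Omega> \<and>
     (\<forall>z\<in>unit_disc. h (f z) = h z + 1) \<and>
     (\<exists>U. fundamental_domain f U \<and> inj_on h U)"

text \<open>Koenigs domains are only determined up to translation, hence a predicate.\<close>

definition koenigs_domain :: "(complex \<Rightarrow> complex) \<Rightarrow> complex set \<Rightarrow> bool" where
  "koenigs_domain f \<Omega> \<longleftrightarrow> (\<exists>h. koenigs_pair f \<Omega> h)"


definition hardy_mean :: "real \<Rightarrow> (complex \<Rightarrow> complex) \<Rightarrow> real \<Rightarrow> real" where
  "hardy_mean p g r =
     integral {0..2*pi} (\<lambda>\<theta>. norm (g (of_real r * cis \<theta>)) powr p) / (2*pi)"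

definition hardy_space :: "real \<Rightarrow> (complex \<Rightarrow> complex) set" where
  "hardy_space p =
     {g. g holomorphic_on unit_disc \<and> bdd_above (hardy_mean p g ` {0..<1})}"

definition hardy_norm :: "real \<Rightarrow> (complex \<Rightarrow> complex) \<Rightarrow> real" where
  "hardy_norm p g = (SUP r\<in>{0..<1}. hardy_mean p g r) powr (1/p)"

definition bergman_space :: "real \<Rightarrow> real \<Rightarrow> (complex \<Rightarrow> complex) set" where
  "bergman_space p \<alpha> =
     {g. g holomorphic_on unit_disc \<and>
         set_integrable lborel unit_disc
           (\<lambda>z. norm (g z) powr p * (1 - (norm z)\<^sup>2) powr \<alpha>)}"

definition bergman_norm :: "real \<Rightarrow> real \<Rightarrow> (complex \<Rightarrow> complex) \<Rightarrow> real" where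
  "bergman_norm p \<alpha> g =
     (set_lebesgue_integral lborel unit_disc
        (\<lambda>z. norm (g z) powr p * (1 - (norm z)\<^sup>2) powr \<alpha>) / pi) powr (1/p)"


definition composition_operator ::
    "(complex \<Rightarrow> complex) \<Rightarrow> (complex \<Rightarrow> complex) \<Rightarrow> (complex \<Rightarrow> complex)" where
  "composition_operator f g = g \<circ> f"

text \<open>
  The least constant \<open>c\<close> with \<open>N (T g) \<le> c * N g\<close> for all \<open>g\<close> in the space \<open>X\<close> with norm \<open>N\<close>.
  The infimum is taken in the extended reals, so it is \<open>\<infinity>\<close> if \<open>T\<close> is not a bounded
  operator from \<open>X\<close> to \<open>X\<close>. The library's \<open>onorm\<close> does not apply because the norm lives
  on a set of functions rather than on a type.
\<close>

definition operator_norm_on ::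
    "(complex \<Rightarrow> complex) set \<Rightarrow> ((complex \<Rightarrow> complex) \<Rightarrow> real) \<Rightarrow>
     ((complex \<Rightarrow> complex) \<Rightarrow> (complex \<Rightarrow> complex)) \<Rightarrow> ereal" where
  "operator_norm_on X N T =
     Inf {ereal c | c. c \<ge> 0 \<and> (\<forall>g\<in>X. T g \<in> X \<and> N (T g) \<le> c * N g)}"

definition hardy_operator_norm ::
    "real \<Rightarrow> ((complex \<Rightarrow> complex) \<Rightarrow> (complex \<Rightarrow> complex)) \<Rightarrow> ereal" where
  "hardy_operator_norm p = operator_norm_on (hardy_space p) (hardy_norm p)"

definition bergman_operator_norm ::
    "real \<Rightarrow> real \<Rightarrow> ((complex \<Rightarrow> complex) \<Rightarrow> (complex \<Rightarrow> complex)) \<Rightarrow> ereal" where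
  "bergman_operator_norm p \<alpha> = operator_norm_on (bergman_space p \<alpha>) (bergman_norm p \<alpha>)"

definition ereal_ln :: "ereal \<Rightarrow> ereal" where
  "ereal_ln x =
     (case x of ereal r \<Rightarrow> (if r \<le> 0 then - \<infinity> else ereal (ln r)) | PInfty \<Rightarrow> \<infinity> | MInfty \<Rightarrow> - \<infinity>)"

end

theory Submission
  imports Defs
begin

text \<open>
  The proof has two independent parts. The norm of a composition operator with symbol \<open>\<phi>\<close> is bounded
  from below by a power of \<open>1 / (1 - (norm (\<phi> 0))\<^sup>2)\<close>, as one sees from a power of the reproducing kernel
  at \<open>\<phi> 0\<close>: the exponent is \<open>1 / p\<close> on the Hardy space (\<open>hardy_composition_norm_ge\<close>), and arbitrarily
  close to \<open>(2 + \<alpha>) / p\<close> on the Bergman space (\<open>bergman_composition_norm_ge\<close>). It remains to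
  show that \<open>1 - (norm ((f ^^ n) 0))\<^sup>2\<close> is at most of the order \<open>n powr - q\<close> for every \<open>q < 1/2\<close>
  (\<open>orbit_approaches_circle\<close>).

  If the Koenigs domain omits \<open>a\<close>, it also omits \<open>a - 1\<close>, \<open>a - 2\<close>, and so on. Hence \<open>H = h - a\<close> is a
  holomorphic function on the disc that omits all non-positive integers, and \<open>H ((f ^^ n) 0) = H 0 + n\<close>.
  So the question is how fast such a function can grow. If it omitted the whole half-line of
  non-positive real numbers, its square root would have positive real part, and the Schwarz lemma would
  give \<open>norm (deriv H z) * (1 - (norm z)\<^sup>2) \<le> 4 * norm (H z)\<close>. By integration \<open>H z\<close> would be of order at most
  \<open>(1 - norm z) powr - 2\<close>, and hence \<open>1 - norm ((f ^^ n) 0)\<close> of order at most \<open>n powr - (1 / 2)\<close>.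
  Omitting only the integers on the half-line is nearly as good: from far away they are
  indistinguishable from the half-line. A normal families argument turns this into the same
  differential inequality with any constant \<open>K > 4\<close>, at all points where \<open>norm (H z)\<close> is large
  (\<open>derivative_bound_at_0_far_out\<close>), and that is all the integration needs
  (\<open>growth_from_logarithmic_derivative\<close>).

  For the Bergman space one needs an upper bound for the integral of a power of the kernel against the
  weight. By the rotation invariance of area measure the integrand may be replaced by its circular
  means, which are estimated through the Poisson kernel (\<open>Forelli_Rudin_estimate\<close>). All small losses in
  exponents are harmless because the theorem is about quotients of logarithms.
\<close>

section \<open>Schwarz lemmas for the half-plane and the slit plane\<close>

text \<open>
  The Schwarz lemma at the origin, after a Cayley transform that sends \<open>q 0\<close> to 0.
\<close>
lemma halfplane_Schwarz:
  assumes q: "q holomorphic_on unit_disc" and pos: "\<And>z. z \<in> unit_disc \<Longrightarrow> 0 < Re (q z)"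
  shows "norm (deriv q 0) \<le> 2 * Re (q 0)"
proof -
  define \<phi> where "\<phi> = (\<lambda>z. (q z - q 0) / (q z + cnj (q 0)))"
  have p0: "0 < Re (q 0)" using pos[of 0] by simp
  have nz: "q z + cnj (q 0) \<noteq> 0" if "z \<in> unit_disc" for z
  proof
    assume "q z + cnj (q 0) = 0"
    then have "Re (q z) + Re (q 0) = 0" by (simp add: complex_eq_iff)
    with pos[OF that] p0 show False by simp
  qed
  have hol: "\<phi> holomorphic_on ball 0 1"
    unfolding \<phi>_def using nz by (intro holomorphic_intros q) auto
  have lt: "norm (\<phi> z) < 1" if "norm z < 1" for z
  proof -
    have z: "z \<in> unit_disc" using that by simp
    have "(norm (q z - q 0))\<^sup>2 < (norm (q z + cnj (q 0)))\<^sup>2"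
      using mult_pos_pos[OF pos[OF z] p0] unfolding cmod_power2 by (simp add: power2_eq_square algebra_simps)
    then have "norm (q z - q 0) < norm (q z + cnj (q 0))" by (rule power_less_imp_less_base) simp
    then show ?thesis using nz[OF z] by (simp add: \<phi>_def norm_divide)
  qed
  have D: "norm (deriv \<phi> 0) \<le> 1"
    by (rule Schwarz_Lemma(2)[OF hol _ lt, of 0]) (auto simp: \<phi>_def)
  have dq: "(q has_field_derivative deriv q 0) (at 0)"
    using holomorphic_derivI[OF q open_ball] by simp
  have nz0: "q 0 + cnj (q 0) \<noteq> 0" using nz[of 0] by simp
  have s: "q 0 + cnj (q 0) = of_real (2 * Re (q 0))" by (simp add: complex_add_cnj)
  have "(\<phi> has_field_derivative deriv q 0 / (q 0 + cnj (q 0))) (at 0)"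
    unfolding \<phi>_def using nz0 by (auto intro!: derivative_eq_intros dq)
  then have "deriv \<phi> 0 = deriv q 0 / of_real (2 * Re (q 0))" using s DERIV_imp_deriv by metis
  with D p0 show ?thesis by (simp add: norm_divide norm_mult divide_simps)
qed

text \<open>
  The constant 4 is where the exponents of the theorem come from: the hyperbolic density of the plane
  slit along the negative half-axis is at least \<open>1 / (4 * norm w)\<close> at \<open>w\<close>, with equality on the
  positive half-axis.
\<close>
lemma slit_plane_derivative_bound:
  assumes g: "g holomorphic_on unit_disc" and slit: "\<And>z. z \<in> unit_disc \<Longrightarrow> g z \<notin> \<real>\<^sub>\<le>\<^sub>0"
  shows "norm (deriv g 0) \<le> 4 * norm (g 0)"
proof -
  \<comment> \<open>the square root maps the slit plane onto the right half-plane\<close>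
  define q where "q = (\<lambda>z. csqrt (g z))"
  have hol: "q holomorphic_on unit_disc"
    unfolding q_def using slit by (intro holomorphic_intros g) auto
  have pos: "0 < Re (q z)" if "z \<in> unit_disc" for z
  proof (rule ccontr)
    assume "\<not> 0 < Re (q z)"
    then have "Re (q z) = 0" using csqrt_principal[of "g z"] by (auto simp: q_def)
    then have "(q z)\<^sup>2 = - of_real ((Im (q z))\<^sup>2)" by (simp add: complex_eq_iff power2_eq_square)
    moreover have "(q z)\<^sup>2 = g z" by (simp add: q_def)
    ultimately have "g z = of_real (- (Im (q z))\<^sup>2)" by simp
    then have "g z \<in> \<real>\<^sub>\<le>\<^sub>0" by (metis neg_le_0_iff_le nonpos_Reals_of_real_iff zero_le_power2)
    with slit[OF that] show False by simp
  qed
  have sq: "g = (\<lambda>z. q z * q z)" by (auto simp: q_def fun_eq_iff simp flip: power2_eq_square)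
  have dq: "(q has_field_derivative deriv q 0) (at 0)"
    using holomorphic_derivI[OF hol open_ball] by simp
  have "deriv g 0 = 2 * q 0 * deriv q 0"
    unfolding sq by (rule DERIV_imp_deriv) (auto intro!: derivative_eq_intros dq)
  then have "norm (deriv g 0) = 2 * norm (q 0) * norm (deriv q 0)" by (simp add: norm_mult)
  also have "\<dots> \<le> 2 * norm (q 0) * (2 * norm (q 0))"
    using halfplane_Schwarz[OF hol pos] complex_Re_le_cmod[of "q 0"] by (intro mult_left_mono) auto
  also have "\<dots> = 4 * norm (g 0)" by (simp add: sq norm_mult)
  finally show ?thesis .
qed

section \<open>Maps that omit the non-positive integers\<close>

text \<open>
  Schottky's theorem in the form in which Montel's theorem asks for it.
\<close>
lemma locally_bounded_omitting_0_1:
  assumes hol: "\<And>h. h \<in> \<H> \<Longrightarrow> h holomorphic_on unit_disc"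
    and nz: "\<And>h z. h \<in> \<H> \<Longrightarrow> z \<in> unit_disc \<Longrightarrow> h z \<noteq> 0 \<and> h z \<noteq> 1"
    and b0: "\<And>h. h \<in> \<H> \<Longrightarrow> norm (h 0) \<le> r"
    and K: "compact K" "K \<subseteq> unit_disc"
  shows "\<exists>B. \<forall>h\<in>\<H>. \<forall>z\<in>K. norm (h z) \<le> B"
proof -
  obtain s where s: "0 < s" "s < 1" "\<And>z. z \<in> K \<Longrightarrow> norm z \<le> s"
  proof (cases "K = {}")
    case True
    then show ?thesis using that[of "1/2"] by auto
  next
    case False
    obtain m where m: "m \<in> K" "\<And>z. z \<in> K \<Longrightarrow> norm z \<le> norm m"
      using continuous_attains_sup[OF K(1) False, of norm] continuous_on_norm_id by blast
    have "norm m < 1" using m K by auto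
    then obtain s where "norm m < s" "s < 1" using dense by blast
    then show ?thesis using that[of s] m(2) norm_ge_zero[of m] by (metis less_imp_le le_less_trans)
  qed
  \<comment> \<open>a dilation by \<open>\<rho>\<close> makes \<open>h\<close> holomorphic on the closed disc and still leaves \<open>K\<close> compactly inside\<close>
  define \<rho> where "\<rho> = sqrt s"
  have \<rho>: "0 < \<rho>" "\<rho> < 1" "\<rho> * \<rho> = s" using s by (auto simp: \<rho>_def)
  have "norm (h z) \<le> exp (pi * exp (pi * (2 + 2 * r + 12 * \<rho> / (1 - \<rho>))))" if h: "h \<in> \<H>" and z: "z \<in> K" for h z
  proof -
    have im: "(\<lambda>z. of_real \<rho> * z) ` cball 0 1 \<subseteq> unit_disc"
    proof (clarsimp simp: norm_mult)
      fix x :: complex assume "norm x \<le> 1"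
      then have "\<bar>\<rho>\<bar> * norm x \<le> \<rho> * 1" using \<rho> by (intro mult_mono) auto
      then show "\<bar>\<rho>\<bar> * norm x < 1" using \<rho> by linarith
    qed
    have "norm ((h \<circ> (\<lambda>z. of_real \<rho> * z)) (z / of_real \<rho>)) \<le> exp (pi * exp (pi * (2 + 2 * r + 12 * \<rho> / (1 - \<rho>))))"
    proof (rule Schottky[where f = "h \<circ> (\<lambda>z. of_real \<rho> * z)"])
      show "(h \<circ> (\<lambda>z. of_real \<rho> * z)) holomorphic_on cball 0 1"
        by (rule holomorphic_on_compose_gen[OF _ hol[OF h] im]) (intro holomorphic_intros)
      show "norm ((h \<circ> (\<lambda>z. of_real \<rho> * z)) 0) \<le> r" using b0[OF h] by simp
      show "\<not> ((h \<circ> (\<lambda>z. of_real \<rho> * z)) z = 0 \<or> (h \<circ> (\<lambda>z. of_real \<rho> * z)) z = 1)"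
        if "z \<in> cball 0 1" for z using nz[OF h] im that unfolding o_def by blast
      show "norm (z / of_real \<rho>) \<le> \<rho>"
        using s(3)[OF z] \<rho> by (simp add: norm_divide divide_le_eq)
    qed (use \<rho> in auto)
    then show ?thesis using \<rho> by simp
  qed
  then show ?thesis by blast
qed

text \<open>
  Hurwitz' theorem with a moving target: the omitted value may depend on the function, as long as it
  converges.
\<close>
lemma Hurwitz_omitted_limit:
  fixes \<F> :: "nat \<Rightarrow> complex \<Rightarrow> complex"
  assumes S: "open S" "connected S"
    and F: "\<And>n. \<F> n holomorphic_on S" and g: "g holomorphic_on S"
    and ul: "\<And>K. \<lbrakk>compact K; K \<subseteq> S\<rbrakk> \<Longrightarrow> uniform_limit K \<F> g sequentially"
    and nonconst: "\<not> g constant_on S"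
    and c: "c \<longlonglongrightarrow> q" and omit: "\<And>n z. z \<in> S \<Longrightarrow> \<F> n z \<noteq> c n"
    and z: "z \<in> S"
  shows "g z \<noteq> q"
proof -
  have "(\<lambda>z. g z - q) z \<noteq> 0"
  proof (rule Hurwitz_no_zeros[OF S, where \<F> = "\<lambda>n z. \<F> n z - c n" and g = "\<lambda>z. g z - q"])
    show "\<And>n. (\<lambda>z. \<F> n z - c n) holomorphic_on S" "(\<lambda>z. g z - q) holomorphic_on S"
      by (intro holomorphic_intros F g)+
    show "uniform_limit K (\<lambda>n z. \<F> n z - c n) (\<lambda>z. g z - q) sequentially"
      if "compact K" "K \<subseteq> S" for K
    proof (intro uniform_limit_intros ul[OF that])
      show "uniform_limit K (\<lambda>n z. c n) (\<lambda>z. q) sequentially"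
        using c by (auto simp: uniform_limit_iff tendsto_iff elim: eventually_mono)
    qed
    show "\<not> (\<lambda>z. g z - q) constant_on S"
      using nonconst by (auto simp: constant_on_def) (metis diff_add_cancel)
    show "\<And>n z. z \<in> S \<Longrightarrow> \<F> n z - c n \<noteq> 0" using omit by simp
  qed (rule z)
  then show ?thesis by simp
qed

text \<open>
  Seen from a point \<open>w\<close> at a large distance, the non-positive integers, scaled by \<open>1 / norm w\<close>, look
  like the whole negative half-axis. So a map into their complement that takes the value \<open>w\<close> at 0
  obeys the bound for the slit plane up to an arbitrarily small loss in the constant. The proof is by
  compactness: a sequence of counterexamples, rescaled to be of modulus about 1 at the origin, is a
  normal family, and its limit violates the bound for the slit plane.
\<close>
lemma derivative_bound_at_0_far_out:
  fixes K :: real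
  assumes K: "K > 4"
  shows "\<exists>R. \<forall>h. h holomorphic_on unit_disc \<and> (\<forall>z\<in>unit_disc. \<forall>k::nat. h z \<noteq> - of_nat k) \<and> R \<le> norm (h 0)
          \<longrightarrow> norm (deriv h 0) \<le> K * norm (h 0)"
proof (rule ccontr)
  assume "\<not> ?thesis"
  then have "\<forall>n::nat. \<exists>h. h holomorphic_on unit_disc \<and> (\<forall>z\<in>unit_disc. \<forall>k::nat. h z \<noteq> - of_nat k)
               \<and> real n + 1 \<le> norm (h 0) \<and> K * norm (h 0) < norm (deriv h 0)"
    by (metis linorder_not_le)
  then obtain h where hol: "\<And>n::nat. h n holomorphic_on unit_disc"
    and omit: "\<And>n z k. z \<in> unit_disc \<Longrightarrow> h n z \<noteq> - of_nat (k::nat)"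
    and big: "\<And>n. real n + 1 \<le> norm (h n 0)" and bad: "\<And>n. K * norm (h n 0) < norm (deriv (h n) 0)"
    by metis
  \<comment> \<open>the scaling factor is an integer, so that every rescaled function omits both 0 and 1\<close>
  define m where "m n = nat \<lfloor>norm (h n 0)\<rfloor>" for n
  have m: "real (m n) \<le> norm (h n 0)" "norm (h n 0) \<le> 2 * real (m n)" "n + 1 \<le> m n" for n
  proof -
    have "int (n + 1) \<le> \<lfloor>norm (h n 0)\<rfloor>" using big[of n] by (simp add: le_floor_iff)
    then show "n + 1 \<le> m n" unfolding m_def by linarith
    then show "real (m n) \<le> norm (h n 0)" "norm (h n 0) \<le> 2 * real (m n)"
      unfolding m_def by linarith+
  qed
  have m0: "real (m n) > 0" for n using m(3)[of n] by simp
  define G where "G n z = - h n z / of_nat (m n)" for n z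
  have holG: "G n holomorphic_on unit_disc" for n
    unfolding G_def using m0[of n] by (intro holomorphic_intros hol) auto
  have omitG: "G n z \<noteq> of_nat k / of_nat (m n)" if "z \<in> unit_disc" for n z k
    using omit[OF that, of n k] m0[of n] by (auto simp: G_def field_simps equation_minus_iff)
  have G0: "1 \<le> norm (G n 0)" "norm (G n 0) \<le> 2" for n
    using m[of n] m0[of n] by (auto simp: G_def norm_divide field_simps)
  have dG: "deriv (G n) 0 = - deriv (h n) 0 / of_nat (m n)" for n
    unfolding G_def using holomorphic_derivI[OF hol[of n] open_ball, of 0] m0[of n]
    by (intro DERIV_imp_deriv) (auto intro!: derivative_eq_intros)
  have badG: "K * norm (G n 0) \<le> norm (deriv (G n) 0)" for n
    using bad[of n] m0[of n] unfolding dG by (simp add: G_def norm_divide divide_simps)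
  obtain g r where g: "g holomorphic_on unit_disc" and r: "strict_mono (r :: nat \<Rightarrow> nat)"
    and pw: "\<And>x. x \<in> unit_disc \<Longrightarrow> (\<lambda>n. G (r n) x) \<longlonglongrightarrow> g x"
    and ul: "\<And>K. \<lbrakk>compact K; K \<subseteq> unit_disc\<rbrakk> \<Longrightarrow> uniform_limit K (G \<circ> r) g sequentially"
  proof (rule Montel[of unit_disc "range G" G])
    show "\<exists>B. \<forall>h\<in>range G. \<forall>z\<in>K. norm (h z) \<le> B" if "compact K" "K \<subseteq> unit_disc" for K
    proof (rule locally_bounded_omitting_0_1[OF _ _ _ that])
      fix h z assume "h \<in> range G" "z \<in> unit_disc"
      then obtain n where [simp]: "h = G n" by auto
      show "h z \<noteq> 0 \<and> h z \<noteq> 1"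
        using omitG[OF \<open>z \<in> _\<close>, of n 0] omitG[OF \<open>z \<in> _\<close>, of n "m n"] m0[of n] by simp
    qed (use holG G0 in auto)
  qed (use holG in auto)
  have dlim: "(\<lambda>n. deriv (G (r n)) 0) \<longlonglongrightarrow> deriv g 0"
  proof -
    have "uniform_limit (ball 0 (1/2)) (G \<circ> r) g sequentially"
      by (rule uniform_limit_on_subset[OF ul[of "cball 0 (1/2)"]]) auto
    from higher_deriv_complex_uniform_limit[OF this _ _ open_ball, of 0 1]
    show ?thesis using holomorphic_on_subset[OF holG, of "ball 0 (1/2)"] by (simp add: o_def subset_ball)
  qed
  have gK: "K * norm (g 0) \<le> norm (deriv g 0)"
    by (rule LIMSEQ_le[OF tendsto_mult_left[OF tendsto_norm[OF pw]] tendsto_norm[OF dlim]]) (use badG in auto)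
  have g1: "1 \<le> norm (g 0)"
    by (rule LIMSEQ_le_const[OF tendsto_norm[OF pw]]) (use G0 in auto)
  have nonconst: "\<not> g constant_on unit_disc"
  proof
    assume "g constant_on unit_disc"
    then obtain c where c: "\<And>z. z \<in> unit_disc \<Longrightarrow> g z = c" by (auto simp: constant_on_def)
    have "((\<lambda>z. c) has_field_derivative 0) (at 0)" by simp
    then have "(g has_field_derivative 0) (at 0)"
      by (rule has_field_derivative_transform_within_open[of _ _ _ unit_disc]) (use c in auto)
    then have "deriv g 0 = 0" by (rule DERIV_imp_deriv)
    moreover have "0 < K * norm (g 0)" using K g1 by (intro mult_pos_pos) linarith+
    ultimately show False using gK by simp
  qed
  \<comment> \<open>the omitted values \<open>k / m\<close> become dense in the half-line, and the limit omits all of it\<close>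
  have "norm (deriv (\<lambda>z. - g z) 0) \<le> 4 * norm (- g 0)"
  proof (rule slit_plane_derivative_bound)
    show "(\<lambda>z. - g z) holomorphic_on unit_disc" by (intro holomorphic_intros g)
    fix z assume z: "z \<in> unit_disc"
    show "- g z \<notin> \<real>\<^sub>\<le>\<^sub>0"
    proof
      assume "- g z \<in> \<real>\<^sub>\<le>\<^sub>0"
      then obtain x where "x \<le> 0" "- g z = of_real x" by (auto simp: nonpos_Reals_def)
      then have "0 \<le> - x" "g z = of_real (- x)" by (simp_all add: equation_minus_iff)
      then obtain t where t: "0 \<le> t" "g z = of_real t" by blast
      define k where "k n = nat \<lfloor>t * real (m (r n))\<rfloor>" for n
      have inf: "filterlim (\<lambda>n. real (m (r n))) at_top sequentially"
      proof (rule filterlim_at_top_mono[OF filterlim_real_sequentially])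
        have "real n \<le> real (m (r n))" for n using m(3)[of "r n"] seq_suble[OF r, of n] by linarith
        then show "\<forall>\<^sub>F n in sequentially. real n \<le> real (m (r n))" by simp
      qed
      have "(\<lambda>n. real (k n) / real (m (r n))) \<longlonglongrightarrow> t"
      proof (rule tendsto_sandwich[of "\<lambda>n. t - 1 / real (m (r n))" _ _ "\<lambda>n. t"])
        have "t * real (m (r n)) - 1 \<le> real (k n) \<and> real (k n) \<le> t * real (m (r n))" for n
          using of_int_floor_le[of "t * real (m (r n))"] real_of_int_floor_gt_diff_one[of "t * real (m (r n))"]
            mult_nonneg_nonneg[OF t(1), of "real (m (r n))"] unfolding k_def by auto
        then have "t - 1 / real (m (r n)) \<le> real (k n) / real (m (r n))" "real (k n) / real (m (r n)) \<le> t" for n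
          using divide_right_mono[of "t * real (m (r n)) - 1" "real (k n)" "real (m (r n))"] m0[of "r n"]
          by (auto simp: diff_divide_distrib divide_le_eq)
        then show "\<forall>\<^sub>F n in sequentially. t - 1 / real (m (r n)) \<le> real (k n) / real (m (r n))"
          "\<forall>\<^sub>F n in sequentially. real (k n) / real (m (r n)) \<le> t"
          by simp_all
        have "(\<lambda>n. 1 / real (m (r n))) \<longlonglongrightarrow> 0"
          by (rule real_tendsto_divide_at_top[OF tendsto_const inf])
        from tendsto_diff[OF tendsto_const this, of t]
        show "(\<lambda>n. t - 1 / real (m (r n))) \<longlonglongrightarrow> t" by simp
      qed simp
      then have "(\<lambda>n. complex_of_real (real (k n) / real (m (r n)))) \<longlonglongrightarrow> of_real t"
        by (rule tendsto_of_real)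
      then have "(\<lambda>n. of_nat (k n) / of_nat (m (r n)) :: complex) \<longlonglongrightarrow> of_real t" by simp
      from Hurwitz_omitted_limit[OF open_ball _ _ g ul nonconst this _ z]
      have "g z \<noteq> of_real t" using holG omitG by auto
      with t show False by simp
    qed
  qed
  then have "norm (deriv g 0) \<le> 4 * norm (g 0)"
    using holomorphic_on_imp_differentiable_at[OF g open_ball, of 0] by simp
  with gK g1 K have "K * norm (g 0) \<le> 4 * norm (g 0)" by linarith
  with g1 K show False by (metis less_le_trans linorder_not_less mult_le_cancel_right zero_less_one)
qed

text \<open>
  Conjugation by a disc automorphism moves the origin to an arbitrary point \<open>a\<close>. A condition
  on the values, here that they lie in \<open>W\<close>, survives this change of variable because \<open>h\<close> and its
  composition with the automorphism have the same range.
\<close>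
lemma derivative_bound_far_out:
  fixes K :: real
  assumes at0: "\<And>h. \<lbrakk>h holomorphic_on unit_disc; h ` unit_disc \<subseteq> W; R \<le> norm (h 0)\<rbrakk>
                  \<Longrightarrow> norm (deriv h 0) \<le> K * norm (h 0)"
    and h: "h holomorphic_on unit_disc" "h ` unit_disc \<subseteq> W"
    and a: "a \<in> unit_disc" and R: "R \<le> norm (h a)"
  shows "norm (deriv h a) * (1 - (norm a)\<^sup>2) \<le> K * norm (h a)"
proof -
  define T where "T = Moebius_function 0 (- a)"
  have na: "norm (- a) < 1" using a by simp
  have T0: "T 0 = a" by (simp add: T_def Moebius_function_of_zero)
  have T: "T holomorphic_on unit_disc" "T ` unit_disc \<subseteq> unit_disc"
    using Moebius_function_holomorphic[OF na] Moebius_function_norm_lt_1[OF na] by (auto simp: T_def)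
  have "((\<lambda>z. (z + a) / (1 + cnj a * z)) has_field_derivative 1 - a * cnj a) (at 0)"
    by (auto intro!: derivative_eq_intros)
  moreover have "T = (\<lambda>z. (z + a) / (1 + cnj a * z))"
    by (simp add: T_def Moebius_function_simple fun_eq_iff)
  ultimately have dT: "(T has_field_derivative 1 - a * cnj a) (at 0)" by simp
  have "(h has_field_derivative deriv h a) (at (T 0))"
    unfolding T0 by (rule holomorphic_derivI[OF h(1) open_ball a])
  from DERIV_chain[OF this dT] have "deriv (h \<circ> T) 0 = deriv h a * (1 - a * cnj a)"
    by (rule DERIV_imp_deriv)
  moreover have "1 - a * cnj a = of_real (1 - (norm a)\<^sup>2)"
    by (metis complex_norm_square of_real_1 of_real_diff)
  ultimately have "norm (deriv (h \<circ> T) 0) = norm (deriv h a) * \<bar>1 - (norm a)\<^sup>2\<bar>"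
    by (simp only: norm_mult norm_of_real)
  moreover have "(norm a)\<^sup>2 < 1" using a by (simp add: abs_square_less_1)
  moreover have "norm (deriv (h \<circ> T) 0) \<le> K * norm ((h \<circ> T) 0)"
  proof (rule at0)
    show "h \<circ> T holomorphic_on unit_disc" by (rule holomorphic_on_compose_gen[OF T(1) h(1) T(2)])
    show "(h \<circ> T) ` unit_disc \<subseteq> W" using T(2) h(2) by fastforce
  qed (use R T0 in simp)
  ultimately show ?thesis using T0 by simp
qed

text \<open>
  Integration of the bound \<open>K / (1 - t\<^sup>2)\<close> for the derivative of \<open>ln (norm h)\<close> along a radius, starting
  at the last point at which the modulus of \<open>h\<close> does not exceed the value from which on the bound is
  available.
\<close>
lemma growth_from_logarithmic_derivative:
  fixes K R :: real
  assumes h: "h holomorphic_on unit_disc" and nz: "\<And>z. z \<in> unit_disc \<Longrightarrow> h z \<noteq> 0"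
    and R: "R > 0"
    and bd: "\<And>z. \<lbrakk>z \<in> unit_disc; R \<le> norm (h z)\<rbrakk> \<Longrightarrow> norm (deriv h z) * (1 - (norm z)\<^sup>2) \<le> K * norm (h z)"
    and K: "K \<ge> 0" and z: "z \<in> unit_disc"
  shows "norm (h z) \<le> max R (norm (h 0)) * ((1 + norm z) / (1 - norm z)) powr (K / 2)"
proof -
  define M where "M = max R (norm (h 0))"
  have M: "M > 0" "R \<le> M" "norm (h 0) \<le> M" using R by (auto simp: M_def)
  define r where "r = norm z"
  have r: "0 \<le> r" "r < 1" using z by (auto simp: r_def)
  define u where "u = sgn z"
  have ru: "of_real r * u = z" by (simp add: u_def r_def sgn_eq)
  have nu: "norm u \<le> 1" by (simp add: u_def norm_sgn)
  have inD: "of_real t * u \<in> unit_disc" if "0 \<le> t" "t \<le> r" for t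
  proof -
    have "t * norm u \<le> r * 1" using that nu by (intro mult_mono) auto
    then show ?thesis using r that by (simp add: norm_mult)
  qed
  have nle: "norm (of_real t * u) \<le> t" if "0 \<le> t" for t
    using mult_left_mono[OF nu that] that by (simp add: norm_mult)
  obtain L where L: "L holomorphic_on unit_disc" "\<And>z. z \<in> unit_disc \<Longrightarrow> exp (L z) = h z"
    using holomorphic_logarithm_exists[OF convex_ball open_ball h nz, of 0] by auto
  have ReL: "Re (L z) = ln (norm (h z))" if "z \<in> unit_disc" for z
    using L(2)[OF that] by (metis ln_exp norm_exp_eq_Re)
  have dL: "deriv L z = deriv h z / h z" if "z \<in> unit_disc" for z
  proof -
    have "((\<lambda>z. exp (L z)) has_field_derivative exp (L z) * deriv L z) (at z)"
      by (rule DERIV_chain2[OF DERIV_exp holomorphic_derivI[OF L(1) open_ball that]])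
    then have "(h has_field_derivative exp (L z) * deriv L z) (at z)"
      by (rule has_field_derivative_transform_within_open[of _ _ _ unit_disc]) (use L(2) that in auto)
    then have "deriv h z = h z * deriv L z" using DERIV_imp_deriv L(2)[OF that] by metis
    then show ?thesis using nz[OF that] by simp
  qed
  define \<phi> where "\<phi> = (\<lambda>t. Re (L (of_real t * u)))"
  have d\<phi>: "(\<phi> has_real_derivative Re (u * deriv L (of_real t * u))) (at t)" if t: "0 \<le> t" "t \<le> r" for t
  proof -
    have "((\<lambda>t. of_real t * u) has_vector_derivative u) (at t)"
      by (auto intro!: derivative_eq_intros)
    from field_vector_diff_chain_at[OF this holomorphic_derivI[OF L(1) open_ball inD[OF t]]]
    have "((\<lambda>t. Re ((L \<circ> (\<lambda>t. of_real t * u)) t)) has_vector_derivative Re (u * deriv L (of_real t * u))) (at t)"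
      by (rule bounded_linear.has_vector_derivative[OF bounded_linear_Re])
    then show ?thesis by (simp add: has_real_derivative_iff_has_vector_derivative \<phi>_def o_def)
  qed
  have cont: "continuous_on {0..r} \<phi>"
    by (intro DERIV_atLeastAtMost_imp_continuous_on) (use d\<phi> in blast)
  \<comment> \<open>twice the hyperbolic distance from 0 to \<open>t\<close>, for the metric with density \<open>1 / (1 - t\<^sup>2)\<close>\<close>
  define \<tau> where "\<tau> t = ln (1 + t) - ln (1 - t)" for t :: real
  have \<tau>0: "0 \<le> \<tau> t" if "0 \<le> t" "t < 1" for t using that by (simp add: \<tau>_def)
  have d\<tau>: "(\<tau> has_real_derivative 2 / (1 - t\<^sup>2)) (at t)" if "0 \<le> t" "t < 1" for t
  proof -
    have "(\<tau> has_real_derivative 1 / (1 + t) + 1 / (1 - t)) (at t)"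
      unfolding \<tau>_def using that by (auto intro!: derivative_eq_intros)
    moreover have "1 / (1 + t) + 1 / (1 - t) = 2 / (1 - t\<^sup>2)"
    proof -
      have "1 - t\<^sup>2 = (1 + t) * (1 - t)" by (simp add: power2_eq_square algebra_simps)
      then show ?thesis using that by (simp add: add_frac_eq)
    qed
    ultimately show ?thesis by simp
  qed
  have "\<phi> r \<le> ln M + K / 2 * \<tau> r"
  proof -
    define S where "S = {t \<in> {0..r}. \<phi> t \<le> ln M}"
    have "S = {0..r} \<inter> \<phi> -` {..ln M}" by (auto simp: S_def)
    then have "closed S" using continuous_closed_preimage[OF cont closed_atLeastAtMost closed_atMost] by simp
    then have cS: "compact S" by (auto simp: compact_eq_bounded_closed S_def intro: bounded_subset[OF bounded_closed_interval[of 0 r]])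
    have "\<phi> 0 \<le> ln M" using ReL[of 0] nz[of 0] M by (simp add: \<phi>_def)
    then have "0 \<in> S" using r by (simp add: S_def)
    then obtain t0 where t0: "t0 \<in> S" "\<And>t. t \<in> S \<Longrightarrow> t \<le> t0"
      using compact_attains_sup[OF cS] by blast
    have t0r: "0 \<le> t0" "t0 \<le> r" "\<phi> t0 \<le> ln M" using t0(1) by (auto simp: S_def)
    \<comment> \<open>after the last time \<open>t0\<close> at which \<open>h\<close> has modulus at most \<open>M\<close>, the bound on the derivative is in force\<close>
    have "(\<lambda>t. \<phi> t - K / 2 * \<tau> t) r \<le> (\<lambda>t. \<phi> t - K / 2 * \<tau> t) t0"
    proof (rule DERIV_nonpos_imp_decreasing_open[OF t0r(2)])
      fix t assume t: "t0 < t" "t < r"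
      define w where "w = of_real t * u"
      have w: "w \<in> unit_disc" using inD[of t] t t0r by (simp add: w_def)
      have t01: "0 \<le> t" "t < 1" using t t0r r by auto
      have "\<not> \<phi> t \<le> ln M" using t0(2)[of t] t t0r by (auto simp: S_def)
      then have "M \<le> norm (h w)" using ReL[OF w] nz[OF w] M(1) by (simp add: \<phi>_def w_def)
      then have b: "norm (deriv h w) * (1 - (norm w)\<^sup>2) \<le> K * norm (h w)" using bd[OF w] M by simp
      have t1: "t\<^sup>2 < 1" using t01 by (simp add: abs_square_less_1)
      have "(norm w)\<^sup>2 \<le> t\<^sup>2" using nle[OF t01(1)] by (simp add: w_def power_mono)
      then have "norm (deriv h w) * (1 - t\<^sup>2) \<le> norm (deriv h w) * (1 - (norm w)\<^sup>2)"
        by (intro mult_left_mono) auto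
      with b have "norm (deriv h w) * (1 - t\<^sup>2) \<le> K * norm (h w)" by linarith
      then have "norm (deriv L w) \<le> K / (1 - t\<^sup>2)"
        using t1 nz[OF w] by (simp add: dL[OF w] norm_divide field_simps)
      moreover have "Re (u * deriv L w) \<le> norm (u * deriv L w)" by (rule complex_Re_le_cmod)
      moreover have "norm (u * deriv L w) \<le> norm (deriv L w)"
        using nu by (simp add: norm_mult mult_left_le_one_le)
      ultimately have "Re (u * deriv L w) - K / 2 * (2 / (1 - t\<^sup>2)) \<le> 0" by simp
      moreover have "((\<lambda>t. \<phi> t - K / 2 * \<tau> t) has_real_derivative Re (u * deriv L w) - K / 2 * (2 / (1 - t\<^sup>2))) (at t)"
        unfolding w_def by (intro DERIV_diff DERIV_cmult d\<phi> d\<tau>) (use t t0r r in auto)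
      ultimately show "\<exists>y. ((\<lambda>t. \<phi> t - K / 2 * \<tau> t) has_real_derivative y) (at t) \<and> y \<le> 0" by blast
    next
      have "continuous_on {t0..r} \<tau>"
        by (intro DERIV_atLeastAtMost_imp_continuous_on) (use d\<tau> t0r r in \<open>meson order_trans le_less_trans\<close>)
      then show "continuous_on {t0..r} (\<lambda>t. \<phi> t - K / 2 * \<tau> t)"
        using t0r by (intro continuous_intros continuous_on_subset[OF cont]) auto
    qed
    moreover have "0 \<le> K / 2 * \<tau> t0" using K \<tau>0[of t0] t0r r by simp
    ultimately show ?thesis using t0r(3) by simp
  qed
  then have "ln (norm (h z)) \<le> ln M + K / 2 * ln ((1 + r) / (1 - r))"
    using ReL[OF z] r by (simp add: \<phi>_def ru \<tau>_def ln_div)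
  also have "\<dots> = ln (M * ((1 + r) / (1 - r)) powr (K / 2))"
    using M r by (simp add: ln_mult ln_powr)
  finally show ?thesis
    using nz[OF z] M r unfolding M_def[symmetric] r_def[symmetric]
    by (subst (asm) ln_le_cancel_iff) auto
qed

section \<open>The rate at which orbits approach the circle\<close>

lemma iterates_on_disc:
  assumes "f holomorphic_on unit_disc" "f ` unit_disc \<subseteq> unit_disc"
  shows "(f ^^ n) holomorphic_on unit_disc \<and> (f ^^ n) ` unit_disc \<subseteq> unit_disc"
proof (induction n)
  case 0
  show ?case by (auto intro: holomorphic_intros simp: id_def)
next
  case (Suc n)
  have "f \<circ> (f ^^ n) holomorphic_on unit_disc"
    by (rule holomorphic_on_compose_gen[OF _ assms(1)]) (use Suc in auto)
  moreover have "(f \<circ> (f ^^ n)) ` unit_disc \<subseteq> unit_disc" using Suc assms(2) by fastforce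
  ultimately show ?case by (simp only: funpow.simps simp_thms)
qed

text \<open>
  A Koenigs function is translated by an omitted value \<open>a\<close>. Since its range is mapped into itself by
  \<open>w \<mapsto> w + 1\<close>, it omits \<open>a - k\<close> together with \<open>a\<close>. Nothing more can be said in general: the Koenigs
  domain may be the complement of such a discrete sequence.
\<close>
lemma koenigs_function_omits_nonpositive_integers:
  assumes "koenigs_domain f \<Omega>" "\<Omega> \<noteq> UNIV" and f: "f ` unit_disc \<subseteq> unit_disc"
  obtains H where "H holomorphic_on unit_disc"
    "\<And>z k. z \<in> unit_disc \<Longrightarrow> H z \<noteq> - of_nat (k::nat)"
    "\<And>n z. z \<in> unit_disc \<Longrightarrow> H ((f ^^ n) z) = H z + of_nat n"
proof -
  obtain h where h: "h holomorphic_on unit_disc" "h ` unit_disc = \<Omega>" "\<And>z. z \<in> unit_disc \<Longrightarrow> h (f z) = h z + 1"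
    and step: "(\<lambda>w. w + 1) ` \<Omega> \<subseteq> \<Omega>"
    using assms(1) by (auto simp: koenigs_domain_def koenigs_pair_def asymptotically_starlike_at_infinity_def)
  obtain a where a: "a \<notin> \<Omega>" using assms(2) by blast
  have up: "w + of_nat k \<in> \<Omega>" if "w \<in> \<Omega>" for w and k :: nat
  proof (induction k)
    case (Suc k)
    have "(w + of_nat k) + 1 \<in> \<Omega>" using step Suc by blast
    then show ?case by (simp add: add_ac)
  qed (use that in simp)
  show ?thesis
  proof (rule that[of "\<lambda>z. h z - a"])
    show "(\<lambda>z. h z - a) holomorphic_on unit_disc" by (intro holomorphic_intros h)
    show "h z - a \<noteq> - of_nat k" if "z \<in> unit_disc" for z k
    proof
      assume "h z - a = - of_nat k"
      then have "h z + of_nat k = a" by (simp add: algebra_simps)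
      moreover have "h z \<in> \<Omega>" using h(2) that by blast
      ultimately show False using up[of "h z" k] a by simp
    qed
    show "h ((f ^^ n) z) - a = h z - a + of_nat n" if "z \<in> unit_disc" for n z
    proof (induction n)
      case (Suc n)
      have "(f ^^ n) z \<in> unit_disc" using f that by (induction n) (simp_all add: image_subset_iff)
      then show ?case using Suc h(3) by simp
    qed simp
  qed
qed

text \<open>
  The translated Koenigs function \<open>H\<close> has modulus about \<open>n\<close> at the \<open>n\<close>-th point of the orbit of 0, and
  by the growth estimate its modulus at \<open>z\<close> is at most a multiple of \<open>(1 - (norm z)\<^sup>2) powr - (K / 2)\<close>
  for every \<open>K > 4\<close>. So the orbit has to approach the circle at least at the rate
  \<open>n powr - (2 / K)\<close>, which is almost \<open>n powr - (1 / 2)\<close>.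
\<close>
lemma orbit_approaches_circle:
  assumes f: "non_elliptic f" and \<Omega>: "koenigs_domain f \<Omega>" "\<Omega> \<noteq> UNIV"
    and q: "0 < q" "q < e / 2"
  shows "\<exists>C>0. \<forall>\<^sub>F n in sequentially. C * real n powr q \<le> (1 - (norm ((f ^^ n) 0))\<^sup>2) powr - e"
proof -
  have f': "f holomorphic_on unit_disc" "f ` unit_disc \<subseteq> unit_disc" using f by (auto simp: non_elliptic_def)
  obtain H where H: "H holomorphic_on unit_disc"
    "\<And>z k. z \<in> unit_disc \<Longrightarrow> H z \<noteq> - of_nat (k::nat)"
    "\<And>n z. z \<in> unit_disc \<Longrightarrow> H ((f ^^ n) z) = H z + of_nat n"
    using koenigs_function_omits_nonpositive_integers[OF \<Omega> f'(2)] by blast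
  \<comment> \<open>chosen such that \<open>n \<le> const * (1 - r\<^sup>2) powr - (K / 2)\<close> becomes the claim when raised to the power \<open>q\<close>\<close>
  define K where "K = 2 * e / q"
  have K: "4 < K" using q by (simp add: K_def field_simps)
  obtain R0 where R0: "\<And>h. \<lbrakk>h holomorphic_on unit_disc; \<And>z k. z \<in> unit_disc \<Longrightarrow> h z \<noteq> - of_nat (k::nat); R0 \<le> norm (h 0)\<rbrakk>
       \<Longrightarrow> norm (deriv h 0) \<le> K * norm (h 0)"
    using derivative_bound_at_0_far_out[OF K] by blast
  define R where "R = max R0 1"
  define W where "W = - range (\<lambda>k::nat. - of_nat k :: complex)"
  define M where "M = max R (norm (H 0))"
  have M: "0 < M" by (simp add: M_def R_def)
  have growth: "norm (H z) \<le> M * ((1 + norm z) / (1 - norm z)) powr (K / 2)" if z: "z \<in> unit_disc" for z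
    unfolding M_def
  proof (rule growth_from_logarithmic_derivative[OF H(1) _ _ _ _ z])
    show "H z \<noteq> 0" if "z \<in> unit_disc" for z using H(2)[OF that, of 0] by simp
    show "norm (deriv H z) * (1 - (norm z)\<^sup>2) \<le> K * norm (H z)" if "z \<in> unit_disc" "R \<le> norm (H z)" for z
    proof (rule derivative_bound_far_out[OF _ H(1) _ that, of W])
      show "norm (deriv h 0) \<le> K * norm (h 0)"
        if h: "h holomorphic_on unit_disc" "h ` unit_disc \<subseteq> W" "R \<le> norm (h 0)" for h
      proof (rule R0[OF h(1)])
        fix z and k :: nat assume "z \<in> unit_disc"
        then have "h z \<in> W" using h(2) by blast
        then show "h z \<noteq> - of_nat k" by (auto simp: W_def)
      qed (use h(3) in \<open>simp add: R_def\<close>)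
      show "H ` unit_disc \<subseteq> W" using H(2) by (auto simp: W_def)
    qed
  qed (use K in \<open>auto simp: R_def\<close>)
  define C where "C = (inverse (2 * M)) powr q * 4 powr - e"
  have approach: "C * real n powr q \<le> (1 - (norm ((f ^^ n) 0))\<^sup>2) powr - e" if n: "2 * norm (H 0) \<le> real n" "0 < n" for n
  proof -
    define r where "r = norm ((f ^^ n) 0)"
    have in1: "(f ^^ n) 0 \<in> unit_disc" using iterates_on_disc[OF f', of n] by (simp add: image_subset_iff)
    then have r: "0 \<le> r" "r < 1" by (auto simp: r_def)
    define d where "d = 1 - r\<^sup>2"
    have d: "0 < d" using r by (simp add: d_def abs_square_less_1)
    have "real n - norm (H 0) \<le> norm (H 0 + of_nat n)"
      using norm_triangle_ineq2[of "of_nat n" "- H 0"] by (simp add: add.commute)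
    then have "real n / 2 \<le> norm (H ((f ^^ n) 0))" using n H(3)[of 0 n] by simp
    also have "\<dots> \<le> M * ((1 + r) / (1 - r)) powr (K / 2)" unfolding r_def by (rule growth[OF in1])
    also have "\<dots> \<le> M * (4 / d) powr (K / 2)"
    proof -
      have "(1 + r) / (1 - r) = (1 + r)\<^sup>2 / d"
        using r d by (simp add: d_def power2_eq_square divide_simps) (simp add: algebra_simps)
      also have "\<dots> \<le> 4 / d"
        using d r power_mono[of "1 + r" 2 2] by (intro divide_right_mono) auto
      finally show ?thesis using M K r by (intro mult_left_mono powr_mono2) auto
    qed
    finally have "inverse (2 * M) * real n \<le> (4 / d) powr (K / 2)" using M by (simp add: field_simps)
    then have "(inverse (2 * M) * real n) powr q \<le> ((4 / d) powr (K / 2)) powr q"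
      using M q by (intro powr_mono2) auto
    also have "((4 / d) powr (K / 2)) powr q = (4 / d) powr e" using q by (simp add: powr_powr K_def)
    finally have "inverse (2 * M) powr q * real n powr q \<le> (4 / d) powr e" by (simp only: powr_mult)
    then have "4 powr - e * (inverse (2 * M) powr q * real n powr q) \<le> 4 powr - e * (4 / d) powr e"
      by (rule mult_left_mono) simp
    also have "4 powr - e * (4 / d) powr e = d powr - e"
    proof -
      have "(4 / d) powr e = 4 powr e / d powr e" by (rule powr_divide)
      then show ?thesis by (simp add: powr_minus inverse_eq_divide)
    qed
    finally show ?thesis unfolding C_def d_def r_def by (simp only: mult_ac)
  qed
  have "\<forall>\<^sub>F n in sequentially. 2 * norm (H 0) \<le> real n"
    using filterlim_real_sequentially unfolding filterlim_at_top by blast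
  then have "\<forall>\<^sub>F n in sequentially. C * real n powr q \<le> (1 - (norm ((f ^^ n) 0))\<^sup>2) powr - e"
    using eventually_gt_at_top[of 0] by eventually_elim (rule approach)
  moreover have "0 < C" using M by (simp add: C_def)
  ultimately show ?thesis by blast
qed

section \<open>Rotation invariance of area measure\<close>

text \<open>
  The image measure \<open>\<nu>\<close> of Lebesgue measure is again translation invariant. For two translation
  invariant \<open>\<sigma>\<close>-finite measures, Fubini's theorem shows that their values on two sets \<open>A\<close> and \<open>B\<close>
  (the latter symmetric) are proportional. For the unit ball \<open>B\<close>, which is its own preimage, the two
  measures agree, so they agree on \<open>A\<close>.
\<close>
lemma distr_lborel_linear_isometry:
  fixes T :: "'a::euclidean_space \<Rightarrow> 'a"
  assumes lin: "linear T" and iso: "\<And>x. norm (T x) = norm x"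
  shows "distr lborel borel T = lborel"
proof (rule measure_eqI)
  have contT: "continuous_on UNIV T" using lin by (rule linear_continuous_on_compose[OF continuous_on_id, simplified])
  then have [measurable]: "T \<in> borel_measurable borel" by (rule borel_measurable_continuous_onI)
  have bij: "bij T" 
    using lin iso by (intro orthogonal_transformation_bij) (simp add: orthogonal_transformation)
  define \<nu> where "\<nu> = distr lborel borel T"
  interpret \<nu>: sigma_finite_measure \<nu>
  proof
    have "emeasure \<nu> (ball 0 (real n)) \<noteq> \<infinity>" for n
    proof -
      have "T -` ball 0 (real n) = ball 0 (real n)" by (auto simp: iso)
      then show ?thesis unfolding \<nu>_def
        by (subst emeasure_distr) (use emeasure_lborel_ball_finite[of 0 "real n"] in \<open>auto simp: less_top\<close>)
    qed
    moreover have "(\<Union>n. ball (0::'a) (real n)) = UNIV"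
      by (auto simp: set_eq_iff intro: reals_Archimedean2)
    ultimately show "\<exists>A. countable A \<and> A \<subseteq> sets \<nu> \<and> \<Union>A = space \<nu> \<and> (\<forall>a\<in>A. emeasure \<nu> a \<noteq> \<infinity>)"
      by (intro exI[of _ "range (\<lambda>n. ball 0 (real n))"]) (auto simp: \<nu>_def)
  qed
  interpret L: sigma_finite_measure "lborel :: 'a measure" by (rule sigma_finite_lborel)
  interpret P: pair_sigma_finite \<nu> "lborel :: 'a measure" ..
  have [measurable_cong]: "sets \<nu> = sets borel" by (simp add: \<nu>_def)
  have trans_\<nu>: "(\<integral>\<^sup>+y. f (y + x) \<partial>\<nu>) = (\<integral>\<^sup>+y. f y \<partial>\<nu>)" if [measurable]: "f \<in> borel_measurable borel" for f x
  proof -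
    obtain c where c: "x = T c" using bij by (metis bij_pointE)
    have "(\<integral>\<^sup>+y. f (y + x) \<partial>\<nu>) = (\<integral>\<^sup>+y. f (T (c + y)) \<partial>lborel)"
      unfolding \<nu>_def c by (subst nn_integral_distr) (auto simp: linear_add[OF lin] add.commute)
    also have "\<dots> = (\<integral>\<^sup>+y. f (T y) \<partial>distr lborel borel ((+) c))"
      by (subst nn_integral_distr) auto
    also have "\<dots> = (\<integral>\<^sup>+y. f y \<partial>\<nu>)"
      unfolding \<nu>_def lborel_distr_plus by (subst nn_integral_distr) auto
    finally show ?thesis .
  qed
  have trans_l: "(\<integral>\<^sup>+y. f (y + x) \<partial>lborel) = (\<integral>\<^sup>+y. f y \<partial>lborel)" if [measurable]: "f \<in> borel_measurable borel" for f and x :: 'a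
  proof -
    have "(\<integral>\<^sup>+y. f (y + x) \<partial>lborel) = (\<integral>\<^sup>+y. f y \<partial>distr lborel borel ((+) x))"
      by (subst nn_integral_distr) (auto simp: add.commute)
    then show ?thesis by (simp add: lborel_distr_plus)
  qed
  show "sets (distr lborel borel T) = sets lborel" by simp
  fix A :: "'a set" assume "A \<in> sets (distr lborel borel T)"
  then have [measurable]: "A \<in> sets borel" by simp
  define B where "B = ball (0::'a) 1"
  have [measurable]: "B \<in> sets borel" by (simp add: B_def)
  have symB: "- x \<in> B \<longleftrightarrow> x \<in> B" for x by (simp add: B_def)
  \<comment> \<open>evaluate the integral of \<open>1\<^sub>A x * 1\<^sub>B (y - x)\<close> against \<open>lborel\<close> in \<open>x\<close> and \<open>\<nu>\<close> in \<open>y\<close> in both orders\<close>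
  have "emeasure \<nu> B * emeasure lborel A = (\<integral>\<^sup>+x. indicator A x * emeasure \<nu> B \<partial>lborel)"
    by (simp add: nn_integral_multc mult.commute)
  also have "\<dots> = (\<integral>\<^sup>+x. (\<integral>\<^sup>+y. indicator A x * indicator B (y - x) \<partial>\<nu>) \<partial>lborel)"
  proof (rule nn_integral_cong)
    fix x
    have "(\<integral>\<^sup>+y. indicator A x * indicator B (y - x) \<partial>\<nu>) = indicator A x * (\<integral>\<^sup>+y. indicator B (y + (- x)) \<partial>\<nu>)"
      by (subst nn_integral_cmult) auto
    also have "(\<integral>\<^sup>+y. indicator B (y + (- x)) \<partial>\<nu>) = emeasure \<nu> B"
      by (subst trans_\<nu>) auto
    finally show "indicator A x * emeasure \<nu> B = (\<integral>\<^sup>+y. indicator A x * indicator B (y - x) \<partial>\<nu>)" by simp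
  qed
  also have "\<dots> = (\<integral>\<^sup>+y. (\<integral>\<^sup>+x. indicator A x * indicator B (y - x) \<partial>lborel) \<partial>\<nu>)"
    by (subst P.Fubini') auto
  also have "\<dots> = (\<integral>\<^sup>+y. (\<integral>\<^sup>+x. indicator A (x + y) * indicator B x \<partial>lborel) \<partial>\<nu>)"
  proof (rule nn_integral_cong)
    fix y
    have "(\<integral>\<^sup>+x. indicator A x * indicator B (y - x) \<partial>lborel) = (\<integral>\<^sup>+x. indicator A (x + y) * indicator B (y - (x + y)) \<partial>lborel)"
      by (subst trans_l[symmetric, of _ y]) auto
    also have "\<dots> = (\<integral>\<^sup>+x. indicator A (x + y) * indicator B x \<partial>lborel)"
      by (intro nn_integral_cong) (simp add: indicator_def symB)
    finally show "(\<integral>\<^sup>+x. indicator A x * indicator B (y - x) \<partial>lborel) = (\<integral>\<^sup>+x. indicator A (x + y) * indicator B x \<partial>lborel)" .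
  qed
  also have "\<dots> = (\<integral>\<^sup>+x. (\<integral>\<^sup>+y. indicator A (x + y) * indicator B x \<partial>\<nu>) \<partial>lborel)"
    by (subst P.Fubini') auto
  also have "\<dots> = (\<integral>\<^sup>+x. emeasure \<nu> A * indicator B x \<partial>lborel)"
  proof (rule nn_integral_cong)
    fix x
    have "(\<integral>\<^sup>+y. indicator A (x + y) * indicator B x \<partial>\<nu>) = (\<integral>\<^sup>+y. indicator A (y + x) \<partial>\<nu>) * indicator B x"
      by (subst nn_integral_multc[symmetric]) (auto simp: add.commute)
    also have "(\<integral>\<^sup>+y. indicator A (y + x) \<partial>\<nu>) = emeasure \<nu> A"
      by (subst trans_\<nu>) auto
    finally show "(\<integral>\<^sup>+y. indicator A (x + y) * indicator B x \<partial>\<nu>) = emeasure \<nu> A * indicator B x" .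
  qed
  also have "\<dots> = emeasure lborel B * emeasure \<nu> A"
    by (subst nn_integral_cmult) (auto simp: mult.commute)
  finally have eq: "emeasure \<nu> B * emeasure lborel A = emeasure lborel B * emeasure \<nu> A" .
  have "T -` B = B" by (auto simp: B_def iso)
  then have BB: "emeasure \<nu> B = emeasure lborel B"
    unfolding \<nu>_def by (subst emeasure_distr) auto
  have "emeasure lborel B \<noteq> \<infinity>" using emeasure_lborel_ball_finite[of "0::'a" 1] by (simp add: B_def)
  moreover have "emeasure lborel B \<noteq> 0"
    unfolding B_def by (simp add: emeasure_ball unit_ball_vol_pos less_imp_neq[OF unit_ball_vol_pos, symmetric])
  ultimately show "emeasure (distr lborel borel T) A = emeasure lborel A"
    using eq BB by (simp add: ennreal_mult_cancel_left \<nu>_def)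
qed

text \<open>
  This reduces an integral over the disc to circular means and an integral of a radial function,
  without polar coordinates.
\<close>
lemma nn_integral_circular_average:
  fixes F :: "complex \<Rightarrow> ennreal"
  assumes [measurable]: "F \<in> borel_measurable borel"
  shows "(\<integral>\<^sup>+z. (\<integral>\<^sup>+\<theta>. F (cis \<theta> * z) * indicator {0..2*pi} \<theta> \<partial>lborel) \<partial>lborel) = ennreal (2 * pi) * (\<integral>\<^sup>+z. F z \<partial>lborel)"
proof -
  have [measurable]: "cis \<in> borel_measurable borel"
    by (intro borel_measurable_continuous_onI continuous_intros)
  have "(\<integral>\<^sup>+z. (\<integral>\<^sup>+\<theta>. F (cis \<theta> * z) * indicator {0..2*pi} \<theta> \<partial>lborel) \<partial>lborel)
      = (\<integral>\<^sup>+\<theta>. (\<integral>\<^sup>+z. F (cis \<theta> * z) * indicator {0..2*pi} \<theta> \<partial>lborel) \<partial>lborel)"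
    by (subst lborel_pair.Fubini') auto
  also have "\<dots> = (\<integral>\<^sup>+\<theta>. (\<integral>\<^sup>+z. F z \<partial>lborel) * indicator {0..2*pi} \<theta> \<partial>lborel)"
  proof (rule nn_integral_cong)
    fix \<theta> :: real
    have "(\<integral>\<^sup>+z. F (cis \<theta> * z) * indicator {0..2*pi} \<theta> \<partial>lborel) = (\<integral>\<^sup>+z. F (cis \<theta> * z) \<partial>lborel) * indicator {0..2*pi} \<theta>"
      by (subst nn_integral_multc) auto
    also have "(\<integral>\<^sup>+z. F (cis \<theta> * z) \<partial>lborel) = (\<integral>\<^sup>+z. F z \<partial>distr lborel borel ((*) (cis \<theta>)))"
      by (subst nn_integral_distr) auto
    also have "distr lborel borel ((*) (cis \<theta>)) = lborel"
      by (rule distr_lborel_linear_isometry) (auto simp: norm_mult intro: linearI simp: algebra_simps)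
    finally show "(\<integral>\<^sup>+z. F (cis \<theta> * z) * indicator {0..2*pi} \<theta> \<partial>lborel) = (\<integral>\<^sup>+z. F z \<partial>lborel) * indicator {0..2*pi} \<theta>" .
  qed
  also have "\<dots> = ennreal (2 * pi) * (\<integral>\<^sup>+z. F z \<partial>lborel)"
    by (subst nn_integral_cmult) (auto simp: mult.commute)
  finally show ?thesis .
qed

lemma emeasure_disc: "r \<ge> 0 \<Longrightarrow> emeasure lborel (ball (c::complex) r) = ennreal (pi * r\<^sup>2)"
  by (simp add: emeasure_ball unit_ball_vol_2)

section \<open>Integrals of powers of the reproducing kernel\<close>

lemma mean_value_circle:
  fixes f :: "complex \<Rightarrow> complex"
  assumes f: "f holomorphic_on cball 0 1"
  shows "((\<lambda>\<theta>. f (cis \<theta>)) has_integral 2 * of_real pi * f 0) {0..2*pi}"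
proof -
  have "((\<lambda>u. f u / (u - 0)) has_contour_integral 2 * of_real pi * \<i> * f 0) (circlepath 0 1)"
    by (rule Cauchy_integral_circlepath_simple[OF f]) simp
  then have "((\<lambda>t. f (cis t) * \<i>) has_integral 2 * of_real pi * \<i> * f 0) {0..2*pi}"
    unfolding circlepath_def by (subst (asm) has_contour_integral_part_circlepath_iff) auto
  from has_integral_mult_left[OF this, of "- \<i>"]
  moreover have "x * \<i> * - \<i> = x" "2 * of_real pi * \<i> * x * - \<i> = 2 * of_real pi * x" for x
    by (simp_all add: mult_ac)
  ultimately show ?thesis by (simp only:)
qed

text \<open>
  The Poisson kernel is the real part of \<open>(1 + a z) / (1 - a z)\<close> on the unit circle, and the mean of the
  latter is its value 1 at the origin.
\<close>
lemma has_integral_Poisson_kernel: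
  fixes a :: complex
  assumes a: "norm a < 1"
  shows "((\<lambda>\<theta>. norm (1 - a * cis \<theta>) powr -2) has_integral 2 * pi / (1 - (norm a)\<^sup>2)) {0..2*pi}"
proof -
  have lt: "norm (a * z) < 1" if "norm z \<le> 1" for z
    using mult_left_mono[OF that norm_ge_zero[of a]] a by (simp add: norm_mult)
  have nz: "1 - a * z \<noteq> 0" if "norm z \<le> 1" for z
    using lt[OF that] by auto
  have "(\<lambda>z. (1 + a * z) / (1 - a * z)) holomorphic_on cball 0 1"
    using nz by (intro holomorphic_intros) auto
  from has_integral_linear[OF mean_value_circle[OF this] bounded_linear_Re]
  have 1: "((\<lambda>\<theta>. Re ((1 + a * cis \<theta>) / (1 - a * cis \<theta>))) has_integral 2 * pi) {0..2*pi}"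
    by (simp add: o_def)
  have "Re ((1 + a * cis \<theta>) / (1 - a * cis \<theta>)) = (1 - (norm a)\<^sup>2) * norm (1 - a * cis \<theta>) powr -2" for \<theta>
  proof -
    define b where "b = a * cis \<theta>"
    have "Re ((1 + b) / (1 - b)) = (1 - (norm b)\<^sup>2) / (norm (1 - b))\<^sup>2"
      unfolding Re_divide cmod_power2 by (simp add: power2_eq_square algebra_simps)
    moreover have "norm b = norm a" by (simp add: b_def norm_mult)
    moreover have "norm (1 - b) > 0" using nz[of "cis \<theta>"] by (simp add: b_def)
    ultimately show ?thesis unfolding b_def[symmetric] by (simp add: powr_minus powr_numeral divide_inverse)
  qed
  then have "((\<lambda>\<theta>. (1 - (norm a)\<^sup>2) * norm (1 - a * cis \<theta>) powr -2) has_integral 2 * pi) {0..2*pi}"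
    using 1 by simp
  from has_integral_mult_right[OF this, of "1 / (1 - (norm a)\<^sup>2)"]
  show ?thesis using a by (simp add: abs_square_eq_1)
qed

lemma ex_dyadic_scale:
  fixes x :: real
  assumes "0 < x" "x \<le> 1"
  shows "\<exists>k::nat. (1/2) ^ Suc k < x \<and> x \<le> (1/2) ^ k"
proof -
  obtain n where n: "(1/2) ^ n < x" using real_arch_pow_inv[of x "1/2"] assms by auto
  define m where "m = (LEAST n. (1/2) ^ n < x)"
  have m: "(1/2) ^ m < x" "\<And>j. j < m \<Longrightarrow> x \<le> (1/2) ^ j"
    unfolding m_def using n by (auto intro: LeastI dest: not_less_Least simp: not_less)
  then have "m \<noteq> 0" using assms by (cases m) auto
  then show ?thesis using m by (metis lessI not0_implies_Suc)
qed

text \<open>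
  The function is compared with a sum over the annuli \<open>V k\<close> at distance at most \<open>2\<^sup>-\<^sup>k\<close> from the circle.
  Their areas are proportional to \<open>2\<^sup>-\<^sup>k\<close>, which gives a geometric series with ratio
  \<open>2 powr - (1 + \<gamma>)\<close>.
\<close>
lemma nn_integral_disc_radial_power_finite:
  assumes \<gamma>: "-1 < \<gamma>" "\<gamma> \<le> 0"
  shows "(\<integral>\<^sup>+z. ennreal ((1 - (norm (z::complex))\<^sup>2) powr \<gamma>) * indicator unit_disc z \<partial>lborel) < \<infinity>"
proof -
  \<comment> \<open>\<open>V k\<close> is the part of the disc where \<open>1 - (norm z)\<^sup>2 \<le> 2\<^sup>-\<^sup>k\<close>\<close>
  define V where "V k = unit_disc - ball 0 (sqrt (1 - (1/2) ^ k))" for k :: nat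
  have [measurable]: "V k \<in> sets borel" for k by (simp add: V_def)
  have vol: "emeasure lborel (V k) = ennreal (pi * (1/2) ^ k)" for k
  proof -
    have p: "(1/2) ^ k \<le> (1::real)" by (rule power_le_one) auto
    then have sub: "ball 0 (sqrt (1 - (1/2) ^ k)) \<subseteq> unit_disc" by (intro subset_ball) simp
    have "emeasure lborel (V k) = emeasure lborel unit_disc - emeasure lborel (ball 0 (sqrt (1 - (1/2) ^ k)) :: complex set)"
      unfolding V_def using sub emeasure_lborel_ball_finite[of "0::complex" "sqrt (1 - (1/2) ^ k)"]
      by (intro emeasure_Diff) auto
    also have "\<dots> = ennreal pi - ennreal (pi * (1 - (1/2) ^ k))"
      using p by (simp add: emeasure_disc)
    also have "\<dots> = ennreal (pi * (1/2) ^ k)"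
      using p by (subst ennreal_minus) (auto simp: algebra_simps)
    finally show ?thesis .
  qed
  define c where "c k = ((1/2) ^ Suc k) powr \<gamma>" for k :: nat
  have "(\<integral>\<^sup>+z. ennreal ((1 - (norm (z::complex))\<^sup>2) powr \<gamma>) * indicator unit_disc z \<partial>lborel)
        \<le> (\<integral>\<^sup>+z. (\<Sum>k. ennreal (c k) * indicator (V k) z) \<partial>lborel)"
  proof (rule nn_integral_mono)
    fix z :: complex
    show "ennreal ((1 - (norm z)\<^sup>2) powr \<gamma>) * indicator unit_disc z \<le> (\<Sum>k. ennreal (c k) * indicator (V k) z)"
    proof (cases "z \<in> unit_disc")
      case True
      then have "0 < 1 - (norm z)\<^sup>2" "1 - (norm z)\<^sup>2 \<le> 1" by (auto simp: abs_square_less_1)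
      then obtain k where k: "(1/2) ^ Suc k < 1 - (norm z)\<^sup>2" "1 - (norm z)\<^sup>2 \<le> (1/2) ^ k"
        using ex_dyadic_scale by blast
      have "sqrt (1 - (1/2) ^ k) \<le> norm z" using k(2) by (intro real_le_lsqrt) auto
      then have "z \<in> V k" using True by (simp add: V_def)
      moreover have "(1 - (norm z)\<^sup>2) powr \<gamma> \<le> c k"
        unfolding c_def using k(1) \<gamma> by (intro powr_mono2') auto
      ultimately have "ennreal ((1 - (norm z)\<^sup>2) powr \<gamma>) * indicator unit_disc z \<le> ennreal (c k) * indicator (V k) z"
        using True by (simp add: ennreal_leI)
      also have "\<dots> \<le> (\<Sum>k. ennreal (c k) * indicator (V k) z)"
      proof -
        have "t k \<le> (\<Sum>k. t k)" for t :: "nat \<Rightarrow> ennreal" using sum_le_suminf[of t "{k}"] by simp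
        then show ?thesis .
      qed
      finally show ?thesis .
    qed simp
  qed
  also have "\<dots> = (\<Sum>k. ennreal (c k) * emeasure lborel (V k))"
    by (subst nn_integral_suminf) (auto simp: nn_integral_cmult)
  also have "\<dots> = (\<Sum>k. ennreal (c k * (pi * (1/2) ^ k)))"
    by (simp add: vol ennreal_mult c_def)
  also have "\<dots> < \<infinity>"
  proof -
    have "c k * (pi * (1/2) ^ k) = (pi * (1/2) powr \<gamma>) * ((1/2) powr (1 + \<gamma>)) ^ k" for k
    proof -
      have "c k = (1/2) powr (\<gamma> * real (Suc k))"
        unfolding c_def by (subst powr_realpow[symmetric]) (simp_all add: powr_powr mult.commute)
      moreover have "(1/2) ^ k = (1/2::real) powr real k" by (simp add: powr_realpow)
      ultimately have "c k * (1/2) ^ k = (1/2) powr (\<gamma> * real (Suc k) + real k)"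
        by (simp only: powr_add)
      also have "\<gamma> * real (Suc k) + real k = \<gamma> + (1 + \<gamma>) * real k" by (simp add: algebra_simps)
      also have "(1/2) powr \<dots> = (1/2) powr \<gamma> * (1/2) powr ((1 + \<gamma>) * real k)" by (rule powr_add)
      also have "(1/2) powr ((1 + \<gamma>) * real k) = ((1/2) powr (1 + \<gamma>)) ^ k"
        by (subst powr_realpow[symmetric]) (simp_all add: powr_powr)
      finally show ?thesis by simp
    qed
    moreover have "summable (\<lambda>k. (pi * (1/2) powr \<gamma>) * ((1/2) powr (1 + \<gamma>)) ^ k)"
      using \<gamma> powr_less_mono2[of "1 + \<gamma>" "1/2::real" 1] by (intro summable_mult summable_geometric) auto
    ultimately have "summable (\<lambda>k. c k * (pi * (1/2) ^ k))" by (simp only:)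
    then show ?thesis by (subst suminf_ennreal2) (auto simp: c_def)
  qed
  finally show ?thesis .
qed

text \<open>
  A version of the Forelli-Rudin estimate. The optimal exponent of \<open>1 - (norm w)\<^sup>2\<close> is \<open>- (s - 2 - \<alpha>)\<close> and
  belongs to \<open>\<beta> = 1 + \<alpha>\<close>, for which the last integral diverges. For every smaller \<open>\<beta>\<close> that integral is
  a finite constant, and the exponent can be brought as close to the optimum as desired. This is enough
  for a statement about logarithmic growth.
\<close>
lemma Forelli_Rudin_estimate:
  fixes w :: complex and \<alpha> \<beta> s :: real
  assumes w: "w \<in> unit_disc" and s: "2 \<le> s" and \<beta>: "0 \<le> \<beta>" "\<beta> \<le> s - 1"
  shows "(\<integral>\<^sup>+z. ennreal (norm (1 - cnj w * z) powr - s * (1 - (norm z)\<^sup>2) powr \<alpha>) * indicator unit_disc z \<partial>lborel)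
     \<le> ennreal (2 powr (s - 2) * (1 - (norm w)\<^sup>2) powr - (s - 1 - \<beta>))
        * (\<integral>\<^sup>+z. ennreal ((1 - (norm (z::complex))\<^sup>2) powr (\<alpha> - \<beta>)) * indicator unit_disc z \<partial>lborel)"
    (is "?I \<le> ennreal ?c * ?J")
proof -
  define F where "F z = ennreal (norm (1 - cnj w * z) powr - s * (1 - (norm z)\<^sup>2) powr \<alpha>) * indicator unit_disc z" for z
  have [measurable]: "F \<in> borel_measurable borel" unfolding F_def
    by (intro borel_measurable_times_ennreal borel_measurable_indicator) auto
  have [measurable]: "cis \<in> borel_measurable borel"
    by (intro borel_measurable_continuous_onI continuous_intros)
  have inner: "(\<integral>\<^sup>+\<theta>. F (cis \<theta> * z) * indicator {0..2*pi} \<theta> \<partial>lborel)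
      \<le> ennreal (2 * pi) * (ennreal ?c * (ennreal ((1 - (norm z)\<^sup>2) powr (\<alpha> - \<beta>)) * indicator unit_disc z))" for z
  proof (cases "z \<in> unit_disc")
    case True
    define a where "a = cnj w * z"
    define y where "y = 1 - (norm a)\<^sup>2"
    have az: "norm a \<le> norm z" "norm a \<le> norm w" 
      using True w by (auto simp: a_def norm_mult mult_left_le_one_le mult_right_le_one_le)
    have a1: "norm a < 1" using az True by auto
    have y: "0 < y" using a1 by (simp add: y_def abs_square_less_1)
    have y2: "y / 2 \<le> 1 - norm a"
    proof -
      have "0 \<le> (1 - norm a)\<^sup>2" by simp
      then show ?thesis by (simp add: y_def power2_eq_square field_simps)
    qed
    have yz: "1 - (norm z)\<^sup>2 \<le> y" and yw: "1 - (norm w)\<^sup>2 \<le> y"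
      using az by (auto simp: y_def power_mono)
    have z0: "0 < 1 - (norm z)\<^sup>2" and w0: "0 < 1 - (norm w)\<^sup>2" using True w by (auto simp: abs_square_less_1)
    \<comment> \<open>all but the power \<open>-2\<close>, whose mean is known exactly, is estimated by its maximum over the circle\<close>
    have pt: "norm (1 - a * cis \<theta>) powr - s \<le> (y / 2) powr - (s - 2) * norm (1 - a * cis \<theta>) powr -2" for \<theta>
    proof -
      have "1 - norm a \<le> norm (1 - a * cis \<theta>)"
        using norm_triangle_ineq2[of 1 "a * cis \<theta>"] by (simp add: norm_mult)
      then have "norm (1 - a * cis \<theta>) powr - (s - 2) \<le> (y / 2) powr - (s - 2)"
        using y y2 s by (intro powr_mono2') auto
      then have "norm (1 - a * cis \<theta>) powr - (s - 2) * norm (1 - a * cis \<theta>) powr -2 \<le> (y / 2) powr - (s - 2) * norm (1 - a * cis \<theta>) powr -2"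
        by (rule mult_right_mono) simp
      then show ?thesis by (simp flip: powr_add)
    qed
    have "(\<integral>\<^sup>+\<theta>. F (cis \<theta> * z) * indicator {0..2*pi} \<theta> \<partial>lborel)
        \<le> (\<integral>\<^sup>+\<theta>. ennreal ((y / 2) powr - (s - 2) * (1 - (norm z)\<^sup>2) powr \<alpha>) * (ennreal (norm (1 - a * cis \<theta>) powr -2) * indicator {0..2*pi} \<theta>) \<partial>lborel)"
    proof (rule nn_integral_mono)
      fix \<theta> :: real
      have "F (cis \<theta> * z) = ennreal (norm (1 - a * cis \<theta>) powr - s * (1 - (norm z)\<^sup>2) powr \<alpha>)"
        using True by (simp add: F_def a_def norm_mult mult_ac)
      also have "\<dots> \<le> ennreal (((y / 2) powr - (s - 2) * (1 - (norm z)\<^sup>2) powr \<alpha>) * norm (1 - a * cis \<theta>) powr -2)"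
        using mult_right_mono[OF pt[of \<theta>], of "(1 - (norm z)\<^sup>2) powr \<alpha>"] by (intro ennreal_leI) (simp add: mult_ac)
      also have "\<dots> = ennreal ((y / 2) powr - (s - 2) * (1 - (norm z)\<^sup>2) powr \<alpha>) * ennreal (norm (1 - a * cis \<theta>) powr -2)"
        by (rule ennreal_mult) auto
      finally show "F (cis \<theta> * z) * indicator {0..2*pi} \<theta> \<le> ennreal ((y / 2) powr - (s - 2) * (1 - (norm z)\<^sup>2) powr \<alpha>) * (ennreal (norm (1 - a * cis \<theta>) powr -2) * indicator {0..2*pi} \<theta>)"
        by (simp add: indicator_def)
    qed
    also have "\<dots> = ennreal ((y / 2) powr - (s - 2) * (1 - (norm z)\<^sup>2) powr \<alpha>) * (\<integral>\<^sup>+\<theta>. ennreal (norm (1 - a * cis \<theta>) powr -2) * indicator {0..2*pi} \<theta> \<partial>lborel)"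
      by (rule nn_integral_cmult) measurable
    also have "(\<integral>\<^sup>+\<theta>. ennreal (norm (1 - a * cis \<theta>) powr -2) * indicator {0..2*pi} \<theta> \<partial>lborel) = ennreal (2 * pi / y)"
      unfolding y_def by (rule nn_integral_has_integral_lebesgue'[OF _ has_integral_Poisson_kernel[OF a1]]) simp
    also have "ennreal ((y / 2) powr - (s - 2) * (1 - (norm z)\<^sup>2) powr \<alpha>) * ennreal (2 * pi / y)
        = ennreal (2 * pi * (2 powr (s - 2) * (y powr - (s - 1)) * (1 - (norm z)\<^sup>2) powr \<alpha>))"
    proof -
      have "(y / 2) powr - (s - 2) / y = 2 powr (s - 2) * y powr - (s - 1)"
      proof -
        have "(y / 2) powr - (s - 2) = y powr - (s - 2) / 2 powr - (s - 2)"
          by (rule powr_divide)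
        then have "(y / 2) powr - (s - 2) = 2 powr (s - 2) * y powr - (s - 2)"
          by (simp only: powr_minus[of 2 "s - 2"] divide_inverse inverse_inverse_eq mult.commute)
        moreover have "y powr - (s - 2) / y = y powr - (s - 1)"
        proof -
          have "- (s - 1) = - (s - 2) + - 1" by simp
          then have "y powr - (s - 1) = y powr - (s - 2) * y powr - 1" by (simp only: powr_add)
          also have "y powr - 1 = inverse y" using y by (simp add: powr_minus)
          finally show ?thesis by (simp only: divide_inverse)
        qed
        ultimately show ?thesis by (metis times_divide_eq_right)
      qed
      then have "(y / 2) powr - (s - 2) * (1 - (norm z)\<^sup>2) powr \<alpha> * (2 * pi / y)
          = 2 * pi * (2 powr (s - 2) * (y powr - (s - 1)) * (1 - (norm z)\<^sup>2) powr \<alpha>)"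
      proof -
        have "P * A * (2 * pi / y) = 2 * pi * (P / y * A)" for P A :: real by simp
        then show ?thesis by (simp only: \<open>(y / 2) powr - (s - 2) / y = 2 powr (s - 2) * y powr - (s - 1)\<close>)
      qed
      then show ?thesis using y by (subst ennreal_mult[symmetric]) auto
    qed
    also have "\<dots> \<le> ennreal (2 * pi * (?c * (1 - (norm z)\<^sup>2) powr (\<alpha> - \<beta>)))"
    proof -
      \<comment> \<open>\<open>y\<close> dominates both \<open>1 - (norm w)\<^sup>2\<close> and \<open>1 - (norm z)\<^sup>2\<close>; \<open>\<beta>\<close> says how the exponent is shared\<close>
      have "y powr - (s - 1) = y powr - (s - 1 - \<beta>) * y powr - \<beta>" by (simp flip: powr_add)
      also have "\<dots> \<le> (1 - (norm w)\<^sup>2) powr - (s - 1 - \<beta>) * (1 - (norm z)\<^sup>2) powr - \<beta>"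
        using yz yw z0 w0 y \<beta> by (intro mult_mono powr_mono2') auto
      finally have "y powr - (s - 1) * (1 - (norm z)\<^sup>2) powr \<alpha> 
          \<le> ((1 - (norm w)\<^sup>2) powr - (s - 1 - \<beta>) * (1 - (norm z)\<^sup>2) powr - \<beta>) * (1 - (norm z)\<^sup>2) powr \<alpha>"
        by (rule mult_right_mono) simp
      also have "\<dots> = (1 - (norm w)\<^sup>2) powr - (s - 1 - \<beta>) * (1 - (norm z)\<^sup>2) powr (\<alpha> - \<beta>)"
        by (simp add: mult.assoc flip: powr_add)
      finally have "2 powr (s - 2) * (y powr - (s - 1) * (1 - (norm z)\<^sup>2) powr \<alpha>) 
         \<le> 2 powr (s - 2) * ((1 - (norm w)\<^sup>2) powr - (s - 1 - \<beta>) * (1 - (norm z)\<^sup>2) powr (\<alpha> - \<beta>))"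
        by (rule mult_left_mono) simp
      then show ?thesis by (intro ennreal_leI) (simp add: mult_ac)
    qed
    also have "\<dots> = ennreal (2 * pi) * (ennreal ?c * (ennreal ((1 - (norm z)\<^sup>2) powr (\<alpha> - \<beta>)) * indicator unit_disc z))"
      using True by (simp add: ennreal_mult mult.assoc)
    finally show ?thesis .
  qed (simp add: F_def norm_mult)
  have "ennreal (2 * pi) * ?I = (\<integral>\<^sup>+z. (\<integral>\<^sup>+\<theta>. F (cis \<theta> * z) * indicator {0..2*pi} \<theta> \<partial>lborel) \<partial>lborel)"
    unfolding F_def[symmetric] by (rule nn_integral_circular_average[symmetric]) measurable
  also have "\<dots> \<le> (\<integral>\<^sup>+z. ennreal (2 * pi) * (ennreal ?c * (ennreal ((1 - (norm z)\<^sup>2) powr (\<alpha> - \<beta>)) * indicator unit_disc z)) \<partial>lborel)"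
    by (intro nn_integral_mono inner)
  also have "\<dots> = ennreal (2 * pi) * (ennreal ?c * ?J)"
  proof -
    have pull: "(\<integral>\<^sup>+z. a * (b * f z) \<partial>lborel) = a * (b * (\<integral>\<^sup>+z. f z \<partial>lborel))"
      if [measurable]: "f \<in> borel_measurable borel" for a b and f :: "complex \<Rightarrow> ennreal"
      by (simp add: nn_integral_cmult)
    show ?thesis
      by (rule pull) (intro borel_measurable_times_ennreal borel_measurable_indicator; auto)
  qed
  finally have "ennreal (2 * pi) * ?I \<le> ennreal (2 * pi) * (ennreal ?c * ?J)" .
  then show ?thesis by (rule ennreal_mult_le_mult_iff[THEN iffD1, rotated 2]) simp_all
qed

section \<open>Lower bounds for norms of composition operators\<close>

text \<open>
  One test function bounds the operator norm from below. The lower bound for the norm of the image may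
  assume that the image lies in the space, as otherwise the operator norm is \<open>\<infinity>\<close>.
\<close>
lemma operator_norm_on_ge:
  assumes g: "g \<in> X" "N g \<le> b" and b: "0 < b" and a: "T g \<in> X \<Longrightarrow> a \<le> N (T g)"
  shows "ereal (a / b) \<le> operator_norm_on X N T"
  unfolding operator_norm_on_def
proof (rule Inf_greatest, clarify)
  fix c :: real assume c: "0 \<le> c" "\<forall>g\<in>X. T g \<in> X \<and> N (T g) \<le> c * N g"
  then have "a \<le> c * N g" using a g(1) by (meson order_trans)
  also have "\<dots> \<le> c * b" using c(1) g(2) by (rule mult_left_mono[rotated])
  finally show "ereal (a / b) \<le> ereal c" using b by (simp add: divide_le_eq)
qed

text \<open>
  The test function for the norm bounds; \<open>q = -1\<close> and \<open>q = -2\<close> are the Szego and the Bergman kernel at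
  \<open>w\<close>. The principal branch of the power is holomorphic on the disc because
  \<open>1 - cnj w * z\<close> has positive real part there.
\<close>
definition kernel_power :: "complex \<Rightarrow> real \<Rightarrow> complex \<Rightarrow> complex" where
  "kernel_power w q z = (1 - cnj w * z) powr of_real q"

lemma kernel_power_holomorphic:
  assumes w: "w \<in> unit_disc"
  shows "kernel_power w q holomorphic_on unit_disc"
proof -
  have "1 - cnj w * z \<notin> \<real>\<^sub>\<le>\<^sub>0" if "z \<in> unit_disc" for z
  proof -
    have "norm (cnj w * z) < 1" using mult_strict_mono'[of "norm w" 1 "norm z" 1] w that by (simp add: norm_mult)
    then have "Re (cnj w * z) < 1" using complex_Re_le_cmod[of "cnj w * z"] by linarith
    then show ?thesis by (auto simp: complex_nonpos_Reals_iff)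
  qed
  then show ?thesis unfolding kernel_power_def by (intro holomorphic_intros) auto
qed

lemma norm_kernel_power_powr:
  assumes "p \<noteq> 0"
  shows "norm (kernel_power w (q / p) z) powr p = norm (1 - cnj w * z) powr q"
  using assms by (simp add: kernel_power_def norm_powr_real_powr' powr_powr)

text \<open>
  The test function is \<open>1 - cnj w * z\<close> to the power \<open>-2 / p\<close>, with \<open>w = \<phi> 0\<close>. The \<open>p\<close>-th power of its norm is at most \<open>1 / (1 - (norm w)\<^sup>2)\<close> by the Poisson integral, and
  the mean over the degenerate circle of radius 0 already shows that composing with \<open>\<phi>\<close> raises it to at
  least the square of that number.
\<close>
lemma hardy_composition_norm_ge:
  assumes \<phi>: "\<phi> holomorphic_on unit_disc" "\<phi> ` unit_disc \<subseteq> unit_disc" and p: "0 < p"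
  shows "ereal ((1 - (norm (\<phi> 0))\<^sup>2) powr - (1 / p)) \<le> hardy_operator_norm p (composition_operator \<phi>)"
proof -
  define w where "w = \<phi> 0"
  have w: "w \<in> unit_disc" using \<phi>(2) by (simp add: w_def image_subset_iff)
  define d where "d = 1 - (norm w)\<^sup>2"
  have d: "0 < d" using w by (simp add: d_def abs_square_less_1)
  define g where "g = kernel_power w (-2 / p)"
  have ng: "norm (g z) powr p = norm (1 - cnj w * z) powr -2" for z
    using norm_kernel_power_powr[of p w "-2" z] p by (simp add: g_def)
  have mean: "hardy_mean p g r \<le> 1 / d" if r: "r \<in> {0..<1}" for r
  proof -
    have le: "norm (cnj w * of_real r) \<le> norm w" using r by (simp add: norm_mult mult_right_le_one_le)
    then have lt: "norm (cnj w * of_real r) < 1" using w by simp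
    then have lt2: "(norm (cnj w * of_real r))\<^sup>2 < 1" by (simp only: abs_square_less_1 abs_norm_cancel)
    have "hardy_mean p g r = 1 / (1 - (norm (cnj w * of_real r))\<^sup>2)"
      unfolding hardy_mean_def ng using integral_unique[OF has_integral_Poisson_kernel[OF lt]] by (simp add: mult.assoc)
    also have "\<dots> \<le> 1 / d"
      using d power_mono[OF le norm_ge_zero, of 2] lt2 unfolding d_def by (intro divide_left_mono mult_pos_pos) auto
    finally show ?thesis .
  qed
  have holg: "g holomorphic_on unit_disc" unfolding g_def by (rule kernel_power_holomorphic[OF w])
  have bdd: "bdd_above (hardy_mean p g ` {0..<1})"
    using mean by (intro bdd_aboveI2)
  have "ereal ((d powr -2) powr (1 / p) / (1 / d) powr (1 / p)) \<le> hardy_operator_norm p (composition_operator \<phi>)"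
    unfolding hardy_operator_norm_def
  proof (rule operator_norm_on_ge)
    show "g \<in> hardy_space p"
      using holg bdd by (simp add: hardy_space_def)
    have "0 \<le> hardy_mean p g 0" by (simp add: hardy_mean_def)
    also have "\<dots> \<le> (SUP r\<in>{0..<1}. hardy_mean p g r)"
      using bdd by (intro cSUP_upper) auto
    finally show "hardy_norm p g \<le> (1 / d) powr (1 / p)"
      unfolding hardy_norm_def using mean p by (intro powr_mono2 cSUP_least) auto
    show "0 < (1 / d) powr (1 / p)" using d by simp
    assume "composition_operator \<phi> g \<in> hardy_space p"
    then have "hardy_mean p (composition_operator \<phi> g) 0 \<le> (SUP r\<in>{0..<1}. hardy_mean p (composition_operator \<phi> g) r)"
      by (intro cSUP_upper) (auto simp: hardy_space_def)
    moreover have "hardy_mean p (composition_operator \<phi> g) 0 = d powr -2"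
    proof -
      have "1 - cnj w * w = of_real d" by (simp add: d_def mult.commute flip: complex_norm_square)
      then show ?thesis using d by (simp add: hardy_mean_def composition_operator_def ng flip: w_def)
    qed
    ultimately show "(d powr -2) powr (1 / p) \<le> hardy_norm p (composition_operator \<phi> g)"
      unfolding hardy_norm_def using p by (intro powr_mono2) auto
  qed
  moreover have "(d powr -2) powr (1 / p) / (1 / d) powr (1 / p) = d powr - (1 / p)"
  proof -
    have "1 / d = d powr -1" using d by (simp add: powr_minus divide_inverse)
    then have "(d powr -2) powr (1 / p) / (1 / d) powr (1 / p) = d powr (-2 * (1 / p) - -1 * (1 / p))"
      by (simp only: powr_powr powr_diff)
    then show ?thesis by simp
  qed
  ultimately show ?thesis by (simp add: d_def w_def)
qed

text \<open>
  By the Schwarz-Pick lemma \<open>\<phi> z\<close> stays within pseudohyperbolic distance \<open>1/2\<close> of \<open>\<phi> 0\<close>. Consequently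
  a power of the reproducing kernel at \<open>\<phi> 0\<close>, composed with \<open>\<phi>\<close>, is as large on the disc of radius
  \<open>1/2\<close> as it is at 0, up to a constant.
\<close>
lemma composition_stays_in_pseudohyperbolic_disc:
  assumes \<phi>: "\<phi> holomorphic_on unit_disc" "\<phi> ` unit_disc \<subseteq> unit_disc" and z: "norm z \<le> 1/2"
  shows "norm (1 - cnj (\<phi> 0) * \<phi> z) \<le> 2 * (1 - (norm (\<phi> 0))\<^sup>2)"
proof -
  define w where "w = \<phi> 0"
  have in1: "norm (\<phi> u) < 1" if "norm u < 1" for u using \<phi>(2) that by (metis image_subset_iff mem_ball_0)
  have w: "norm w < 1" using in1[of 0] by (simp add: w_def)
  define M where "M = Moebius_function 0 w \<circ> \<phi>"
  have M: "M holomorphic_on unit_disc"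
    unfolding M_def by (rule holomorphic_on_compose_gen[OF \<phi>(1) Moebius_function_holomorphic[OF w] \<phi>(2)])
  have "norm (M z) \<le> norm z"
    by (rule Schwarz_Lemma(1)[OF M])
      (use z in1 Moebius_function_norm_lt_1[OF w] in \<open>auto simp: M_def w_def Moebius_function_eq_zero\<close>)
  moreover have nz: "1 - cnj w * \<phi> z \<noteq> 0"
  proof -
    have "norm (cnj w * \<phi> z) < 1" using mult_strict_mono'[OF w in1[of z]] z by (simp add: norm_mult)
    then show ?thesis by auto
  qed
  ultimately have "norm (\<phi> z - w) \<le> norm z * norm (1 - cnj w * \<phi> z)"
    by (simp add: M_def Moebius_function_simple norm_divide pos_divide_le_eq)
  also have "\<dots> \<le> 1/2 * norm (1 - cnj w * \<phi> z)" using z by (rule mult_right_mono) simp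
  finally have "norm (\<phi> z - w) \<le> 1/2 * norm (1 - cnj w * \<phi> z)" .
  moreover have "norm (cnj w * (\<phi> z - w)) \<le> norm (\<phi> z - w)"
    using w by (simp add: norm_mult mult_left_le_one_le)
  moreover have "1 - cnj w * \<phi> z = of_real (1 - (norm w)\<^sup>2) - cnj w * (\<phi> z - w)"
    by (simp add: algebra_simps complex_norm_square del: of_real_power)
  then have "norm (1 - cnj w * \<phi> z) \<le> \<bar>1 - (norm w)\<^sup>2\<bar> + norm (cnj w * (\<phi> z - w))"
    by (metis norm_of_real norm_triangle_ineq4)
  moreover have "(norm w)\<^sup>2 < 1" using w by (simp add: abs_square_less_1)
  ultimately show ?thesis unfolding w_def[symmetric] by simp
qed

text \<open>
  The test function is \<open>1 - cnj w * z\<close> to the power \<open>- s / p\<close> with \<open>w = \<phi> 0\<close>. Its norm is controlled by the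
  Forelli-Rudin estimate. The norm of its composition with \<open>\<phi>\<close> is bounded from below by the integral over
  the disc of radius \<open>1/2\<close>, on which the composition has modulus at least of the order of its value
  at 0. The condition \<open>\<alpha> \<le> \<beta>\<close> makes the radial exponent \<open>\<alpha> - \<beta>\<close> non-positive; the constant depends on
  \<open>\<beta>\<close>, but not on \<open>\<phi>\<close>.
\<close>
lemma bergman_composition_norm_ge:
  assumes p: "0 < p" and \<alpha>: "-1 < \<alpha>" and \<beta>: "0 \<le> \<beta>" "\<alpha> \<le> \<beta>" "\<beta> < 1 + \<alpha>"
  obtains C where "0 < C" "\<And>\<phi>. \<lbrakk>\<phi> holomorphic_on unit_disc; \<phi> ` unit_disc \<subseteq> unit_disc\<rbrakk>
     \<Longrightarrow> ereal (C * (1 - (norm (\<phi> 0))\<^sup>2) powr - ((1 + \<beta>) / p)) \<le> bergman_operator_norm p \<alpha> (composition_operator \<phi>)"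
proof -
  \<comment> \<open>the exponent cancels from the final bound; it only has to satisfy \<open>s \<ge> 2\<close> and \<open>\<beta> \<le> s - 1\<close>\<close>
  define s where "s = 3 + \<alpha>"
  define J where "J = (\<integral>\<^sup>+z. ennreal ((1 - (norm (z::complex))\<^sup>2) powr (\<alpha> - \<beta>)) * indicator unit_disc z \<partial>lborel)"
  have "J < \<infinity>" unfolding J_def using \<alpha> \<beta> by (intro nn_integral_disc_radial_power_finite) auto
  \<comment> \<open>1 is added because \<open>j\<close> will be a denominator and has to be positive\<close>
  define j where "j = enn2real J + 1"
  have j: "J \<le> ennreal j" "0 < j"
    using \<open>J < \<infinity>\<close> by (auto simp: j_def enn2real_nonneg add_nonneg_pos intro!: order_trans[OF _ ennreal_leI[of "enn2real J"]])
  define c where "c = 2 powr (s - 2) * j / pi"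
  define m where "m = 2 powr - s * (3/4) powr \<bar>\<alpha>\<bar> / 4"
  have c: "0 < c" and m: "0 < m" using j by (auto simp: c_def m_def)
  show ?thesis
  proof (rule that[of "(m / c) powr (1 / p)"])
    show "0 < (m / c) powr (1 / p)" using c m by simp
    fix \<phi> assume \<phi>: "\<phi> holomorphic_on unit_disc" "\<phi> ` unit_disc \<subseteq> unit_disc"
    define w where "w = \<phi> 0"
    have w: "w \<in> unit_disc" using \<phi>(2) by (simp add: w_def image_subset_iff)
    define d where "d = 1 - (norm w)\<^sup>2"
    have d: "0 < d" using w by (simp add: d_def abs_square_less_1)
    define g where "g = kernel_power w (- s / p)"
    have holg: "g holomorphic_on unit_disc" unfolding g_def by (rule kernel_power_holomorphic[OF w])
    have ng: "norm (g z) powr p = norm (1 - cnj w * z) powr - s" for z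
      using norm_kernel_power_powr[of p w "- s" z] p by (simp add: g_def)
    define G where "G z = norm (1 - cnj w * z) powr - s * (1 - (norm z)\<^sup>2) powr \<alpha>" for z
    have [measurable]: "G \<in> borel_measurable borel" unfolding G_def by measurable
    have Gn: "0 \<le> G z" for z by (simp add: G_def)
    have "(\<integral>\<^sup>+z. ennreal (indicator unit_disc z *\<^sub>R G z) \<partial>lborel) = (\<integral>\<^sup>+z. ennreal (G z) * indicator unit_disc z \<partial>lborel)"
      by (intro nn_integral_cong) (simp add: indicator_def)
    also have "\<dots> \<le> ennreal (2 powr (s - 2) * d powr - (s - 1 - \<beta>)) * J"
      unfolding G_def d_def J_def by (rule Forelli_Rudin_estimate[OF w]) (use \<alpha> \<beta> in \<open>auto simp: s_def\<close>)
    also have "\<dots> \<le> ennreal (2 powr (s - 2) * d powr - (s - 1 - \<beta>)) * ennreal j"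
      using j by (intro mult_left_mono) auto
    also have "\<dots> = ennreal (pi * (c * d powr - (s - 1 - \<beta>)))"
      using j by (simp add: c_def mult_ac flip: ennreal_mult)
    finally have nnG: "(\<integral>\<^sup>+z. ennreal (indicator unit_disc z *\<^sub>R G z) \<partial>lborel) \<le> ennreal (pi * (c * d powr - (s - 1 - \<beta>)))" .
    have meas: "(\<lambda>z. indicator unit_disc z *\<^sub>R G z) \<in> borel_measurable borel"
      by (intro borel_measurable_scaleR borel_measurable_indicator) auto
    have intG: "set_integrable lborel unit_disc G"
      unfolding set_integrable_def
      by (rule integrableI_nonneg) (use nnG Gn meas in \<open>auto simp: top_unique less_top[symmetric] intro: le_less_trans\<close>)
    have leG: "set_lebesgue_integral lborel unit_disc G \<le> pi * (c * d powr - (s - 1 - \<beta>))"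
      unfolding set_lebesgue_integral_def
      by (rule order_trans[OF integral_real_bounded[OF _ nnG]]) (use c in auto)
    have "ereal ((m * d powr - s) powr (1 / p) / (c * d powr - (s - 1 - \<beta>)) powr (1 / p))
        \<le> bergman_operator_norm p \<alpha> (composition_operator \<phi>)"
      unfolding bergman_operator_norm_def
    proof (rule operator_norm_on_ge)
      show "g \<in> bergman_space p \<alpha>"
        using holg intG unfolding bergman_space_def mem_Collect_eq ng G_def by simp
      have "0 \<le> set_lebesgue_integral lborel unit_disc G"
        unfolding set_lebesgue_integral_def by (intro integral_nonneg_AE) (use Gn in auto)
      then show "bergman_norm p \<alpha> g \<le> (c * d powr - (s - 1 - \<beta>)) powr (1 / p)"
        unfolding bergman_norm_def ng G_def[symmetric] using leG p
        by (intro powr_mono2) (auto simp: divide_le_eq mult_ac)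
      show "0 < (c * d powr - (s - 1 - \<beta>)) powr (1 / p)" using c d by simp
      assume T: "composition_operator \<phi> g \<in> bergman_space p \<alpha>"
      define H where "H z = norm (g (\<phi> z)) powr p * (1 - (norm z)\<^sup>2) powr \<alpha>" for z
      have intH: "integrable lborel (\<lambda>z. indicator unit_disc z *\<^sub>R H z)"
        using T unfolding bergman_space_def set_integrable_def composition_operator_def H_def by simp
      define k where "k = (2 * d) powr - s * (3/4) powr \<bar>\<alpha>\<bar>"
      have "pi / 4 * k = (LINT z|lborel. indicator (ball 0 (1/2)) (z::complex) *\<^sub>R k)"
        using emeasure_disc[of "1/2" 0] emeasure_lborel_ball_finite[of "0::complex" "1/2"]
        by (simp add: measure_def power2_eq_square)
      also have "\<dots> \<le> (LINT z|lborel. indicator unit_disc z *\<^sub>R H z)"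
      proof (rule integral_mono)
        show "integrable lborel (\<lambda>z::complex. indicator (ball 0 (1/2)) z *\<^sub>R k)"
          using emeasure_lborel_ball_finite[of "0::complex" "1/2"] by (intro integrable_scaleR_left integrable_real_indicator) auto
        show "indicator (ball 0 (1/2)) z *\<^sub>R k \<le> indicator unit_disc z *\<^sub>R H z" for z :: complex
        proof (cases "z \<in> ball 0 (1/2)")
          case True
          then have z: "norm z \<le> 1/2" and zD: "z \<in> unit_disc" by auto
          have "norm (\<phi> z) < 1" using \<phi>(2) zD by (metis image_subset_iff mem_ball_0)
          then have "norm (cnj w * \<phi> z) < 1" using w mult_strict_mono'[of "norm w" 1 "norm (\<phi> z)" 1] by (simp add: norm_mult)
          then have "0 < norm (1 - cnj w * \<phi> z)" by auto
          moreover have "norm (1 - cnj w * \<phi> z) \<le> 2 * d"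
            using composition_stays_in_pseudohyperbolic_disc[OF \<phi> z] by (simp add: w_def d_def)
          ultimately have 1: "(2 * d) powr - s \<le> norm (g (\<phi> z)) powr p"
            unfolding ng using \<alpha> by (intro powr_mono2') (auto simp: s_def)
          have "(norm z)\<^sup>2 \<le> (1/2)\<^sup>2" using z by (intro power_mono) auto
          then have x: "3/4 \<le> 1 - (norm z)\<^sup>2" "1 - (norm z)\<^sup>2 \<le> 1" by (auto simp: power2_eq_square)
          have "(3/4) powr \<bar>\<alpha>\<bar> \<le> (1 - (norm z)\<^sup>2) powr \<bar>\<alpha>\<bar>" using x by (intro powr_mono2) auto
          also have "\<dots> \<le> (1 - (norm z)\<^sup>2) powr \<alpha>" using x by (intro powr_mono') auto
          finally have "k \<le> H z" unfolding k_def H_def using 1 by (intro mult_mono) auto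
          then show ?thesis using True zD by simp
        qed (simp add: H_def)
      qed (rule intH)
      finally have kH: "pi / 4 * k \<le> set_lebesgue_integral lborel unit_disc H" by (simp add: set_lebesgue_integral_def)
      have "m * d powr - s = pi / 4 * k / pi"
        using d by (simp add: m_def k_def powr_mult)
      also have "\<dots> \<le> set_lebesgue_integral lborel unit_disc H / pi"
        by (rule divide_right_mono[OF kH]) simp
      finally have "m * d powr - s \<le> set_lebesgue_integral lborel unit_disc H / pi" .
      then show "(m * d powr - s) powr (1 / p) \<le> bergman_norm p \<alpha> (composition_operator \<phi> g)"
        unfolding bergman_norm_def H_def composition_operator_def o_def
        using m p by (intro powr_mono2) auto
    qed
    also have "(m * d powr - s) powr (1 / p) / (c * d powr - (s - 1 - \<beta>)) powr (1 / p)
        = (m / c) powr (1 / p) * d powr - ((1 + \<beta>) / p)"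
    proof -
      have "(m * d powr - s) / (c * d powr - (s - 1 - \<beta>)) = m / c * d powr (- s - - (s - 1 - \<beta>))"
        by (simp only: powr_diff times_divide_times_eq)
      also have "- s - - (s - 1 - \<beta>) = - (1 + \<beta>)" by simp
      finally have "(m * d powr - s) / (c * d powr - (s - 1 - \<beta>)) = m / c * d powr - (1 + \<beta>)" .
      then have "(m * d powr - s) powr (1 / p) / (c * d powr - (s - 1 - \<beta>)) powr (1 / p)
          = (m / c * d powr - (1 + \<beta>)) powr (1 / p)"
        by (simp only: powr_divide[symmetric])
      also have "\<dots> = (m / c) powr (1 / p) * d powr (- (1 + \<beta>) * (1 / p))"
        by (simp only: powr_mult powr_powr)
      also have "- (1 + \<beta>) * (1 / p) = - ((1 + \<beta>) / p)"
        by (simp only: mult_minus_left times_divide_eq_right mult_1_right)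
      finally show ?thesis .
    qed
    finally show "ereal ((m / c) powr (1 / p) * (1 - (norm (\<phi> 0))\<^sup>2) powr - ((1 + \<beta>) / p))
       \<le> bergman_operator_norm p \<alpha> (composition_operator \<phi>)" by (simp add: d_def w_def)
  qed
qed

section \<open>Logarithmic growth of the norms\<close>

lemma ereal_ln_mono:
  assumes "0 < x" "ereal x \<le> A"
  shows "ereal (ln x) \<le> ereal_ln A"
  using assms by (cases A) (auto simp: ereal_ln_def)

text \<open>
  Constants disappear in the quotient of logarithms, and an arbitrarily small loss in the exponent
  disappears in the lower limit. This is why no estimate above has to be sharp in its exponent.
\<close>
lemma liminf_log_ge_of_powers:
  fixes A :: "nat \<Rightarrow> ereal"
  assumes Q: "0 < Q"
    and pow: "\<And>q. \<lbrakk>0 < q; q < Q\<rbrakk> \<Longrightarrow> \<exists>C>0. \<forall>\<^sub>F n in sequentially. ereal (C * real n powr q) \<le> A n"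
  shows "ereal Q \<le> liminf (\<lambda>n. ereal_ln (A n) / ereal (ln (real n)))"
  unfolding le_Liminf_iff
proof (intro allI impI)
  fix y assume "y < ereal Q"
  then obtain r where r: "y < ereal r" "r < Q" using ereal_dense2 by (metis less_ereal.simps(1))
  obtain q where q: "max r 0 < q" "q < Q" using dense[of "max r 0" Q] r Q by auto
  obtain C where C: "C > 0" "\<forall>\<^sub>F n in sequentially. ereal (C * real n powr q) \<le> A n" using pow[of q] q by auto
  have "filterlim (\<lambda>n. ln (real n)) at_top sequentially"
    by (rule filterlim_compose[OF ln_at_top filterlim_real_sequentially])
  then have big: "\<forall>\<^sub>F n in sequentially. max 1 (- ln C / (q - r)) < ln (real n)"
    unfolding filterlim_at_top_dense by blast
  show "\<forall>\<^sub>F n in sequentially. y < ereal_ln (A n) / ereal (ln (real n))"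
    using C(2) big eventually_gt_at_top[of 0]
  proof eventually_elim
    case (elim n)
    have "- ln C / (q - r) < ln (real n)" using elim(2) by simp
    then have "- ln C < ln (real n) * (q - r)" using q by (subst (asm) pos_divide_less_eq) auto
    then have l: "0 < ln (real n)" "- ln C < (q - r) * ln (real n)" using elim(2) by (auto simp: mult.commute)
    have "ereal (ln (C * real n powr q)) \<le> ereal_ln (A n)" using C(1) elim by (intro ereal_ln_mono) auto
    moreover have "ln (C * real n powr q) = ln C + q * ln (real n)" using C(1) elim(3) by (simp add: ln_mult ln_powr)
    ultimately have "ereal (ln C + q * ln (real n)) / ereal (ln (real n)) \<le> ereal_ln (A n) / ereal (ln (real n))"
      using l by (intro ereal_divide_right_mono) auto
    moreover have "r \<le> (ln C + q * ln (real n)) / ln (real n)" using l by (simp add: pos_le_divide_eq algebra_simps)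
    ultimately have "ereal r \<le> ereal_ln (A n) / ereal (ln (real n))" using l by (simp add: order_trans[rotated])
    then show ?case using r(1) by (rule less_le_trans[rotated])
  qed
qed

theorem corollary1p4:
  fixes f :: "complex \<Rightarrow> complex" and \<Omega> :: "complex set" and p \<alpha> :: real
  assumes "non_elliptic f"
    and "koenigs_domain f \<Omega>" and "\<Omega> \<noteq> UNIV"
    and "p \<ge> 1" and "\<alpha> > -1"
  shows "liminf (\<lambda>n. ereal_ln (hardy_operator_norm p (composition_operator (f ^^ n)))
                       / ereal (ln (real n))) \<ge> ereal (1 / (2 * p))
       \<and> liminf (\<lambda>n. ereal_ln (bergman_operator_norm p \<alpha> (composition_operator (f ^^ n)))
                       / ereal (ln (real n))) \<ge> ereal ((2 + \<alpha>) / (2 * p))"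
proof
  have p: "0 < p" using assms(4) by simp
  note orbit = orbit_approaches_circle[OF assms(1-3)]
  have it: "(f ^^ n) holomorphic_on unit_disc" "(f ^^ n) ` unit_disc \<subseteq> unit_disc" for n
    using assms(1) iterates_on_disc[of f n] by (auto simp: non_elliptic_def)
  show "ereal (1 / (2 * p)) \<le> liminf (\<lambda>n. ereal_ln (hardy_operator_norm p (composition_operator (f ^^ n))) / ereal (ln (real n)))"
  proof (rule liminf_log_ge_of_powers)
    fix q assume "0 < q" "q < 1 / (2 * p)"
    then obtain C where C: "0 < C" "\<forall>\<^sub>F n in sequentially. C * real n powr q \<le> (1 - (norm ((f ^^ n) 0))\<^sup>2) powr - (1 / p)"
      using orbit[of q "1 / p"] by (auto simp: mult.commute)
    have "\<forall>\<^sub>F n in sequentially. ereal (C * real n powr q) \<le> hardy_operator_norm p (composition_operator (f ^^ n))"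
      using C(2)
    proof eventually_elim
      case (elim n)
      then show ?case
        by (intro order_trans[OF _ hardy_composition_norm_ge[OF it p]]) simp
    qed
    with C(1) show "\<exists>C>0. \<forall>\<^sub>F n in sequentially. ereal (C * real n powr q) \<le> hardy_operator_norm p (composition_operator (f ^^ n))"
      by blast
  qed (use p in simp)
  show "ereal ((2 + \<alpha>) / (2 * p)) \<le> liminf (\<lambda>n. ereal_ln (bergman_operator_norm p \<alpha> (composition_operator (f ^^ n))) / ereal (ln (real n)))"
  proof (rule liminf_log_ge_of_powers)
    fix q assume q: "0 < q" "q < (2 + \<alpha>) / (2 * p)"
    \<comment> \<open>\<open>\<beta>\<close> is taken so close to \<open>1 + \<alpha>\<close> that the exponent \<open>(1 + \<beta>) / p\<close> still yields \<open>q\<close>\<close>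
    then have "2 * p * q < 2 + \<alpha>" using p by (simp add: field_simps)
    then have "max (max 0 \<alpha>) (2 * p * q - 1) < 1 + \<alpha>" using assms(5) by auto
    then obtain \<beta> where \<beta>: "max (max 0 \<alpha>) (2 * p * q - 1) < \<beta>" "\<beta> < 1 + \<alpha>" using dense by blast
    have "q < ((1 + \<beta>) / p) / 2" using \<beta> p by (simp add: field_simps)
    then obtain C where C: "0 < C" "\<forall>\<^sub>F n in sequentially. C * real n powr q \<le> (1 - (norm ((f ^^ n) 0))\<^sup>2) powr - ((1 + \<beta>) / p)"
      using orbit[OF q(1)] by blast
    obtain B where B: "0 < B" "\<And>\<phi>. \<lbrakk>\<phi> holomorphic_on unit_disc; \<phi> ` unit_disc \<subseteq> unit_disc\<rbrakk>
     \<Longrightarrow> ereal (B * (1 - (norm (\<phi> 0))\<^sup>2) powr - ((1 + \<beta>) / p)) \<le> bergman_operator_norm p \<alpha> (composition_operator \<phi>)"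
      using bergman_composition_norm_ge[OF p assms(5), of \<beta>] \<beta> by auto
    have "\<forall>\<^sub>F n in sequentially. ereal ((B * C) * real n powr q) \<le> bergman_operator_norm p \<alpha> (composition_operator (f ^^ n))"
      using C(2)
    proof eventually_elim
      case (elim n)
      then have "B * (C * real n powr q) \<le> B * (1 - (norm ((f ^^ n) 0))\<^sup>2) powr - ((1 + \<beta>) / p)"
        using B(1) by (intro mult_left_mono) auto
      then show ?case by (intro order_trans[OF _ B(2)[OF it]]) (simp add: mult.assoc)
    qed
    moreover have "0 < B * C" using B(1) C(1) by simp
    ultimately show "\<exists>C>0. \<forall>\<^sub>F n in sequentially. ereal (C * real n powr q) \<le> bergman_operator_norm p \<alpha> (composition_operator (f ^^ n))"
      by blast
  qed (use p assms(5) in simp)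
qed

end
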